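(* There exists a universal constant $C\in(0,1]$ such that the following holds. Let $\mu$ be the Lebesgue measure on $\mathbb R$, $n\ge3$, and let $\overline S$ be the set of all probability densities of the form $t=f\mathbf 1_{(\overline x,+\infty)}$ where $\overline x\in\mathbb R$ and $f$ is a non-negative, non-increasing function on $(\overline x,+\infty)$ with $\int_{\overline x}^{+\infty}f(x)\,dx=1$. Then, for every density $s\in\mathscr L_\mu$, any $\rho$-estimator $\widehat s$ of $s$ on $\overline S$ satisfies $$C\,\mathbb E_s\left[h^2(s,\widehat s)\right]\le\inf_{\overline M\ge0}\left[h^2\left(s,\overline S(\overline M)\right)+\left(\left(\overline M^{1/3}n^{-2/3}(\log n)^2\right)\vee\left(n^{-1}(\log n)^3\right)\right)\right].$$
   Context: Setting. $\mu$ is the Lebesgue measure on $\mathbb R$ and $\mathscr L_\mu$ is the set of probability densities on $\mathbb R$ with respect to $\mu$. The Hellinger distance is $h(t,u)=\left[\frac12\int(\sqrt t-\sqrt u)^2d\mu\right]^{1/2}$, and $h(t,A)=\inf_{u\in A}h(t,u)$ for $A\subset\mathscr L_\mu$. One observes i.i.d. random variables $X_1,\dots,X_n$ ($n\ge3$) with density $s\in\mathscr L_\mu$; $\mathbb E_s$ is the expectation when the true density is $s$. $a\vee b=\max(a,b)$. For $f$ monotone on the interior $\mathring I$ of an interval $I$ of positive length, its variation is $V_I(f)=\sup_{\mathring I}f-\inf_{\mathring I}f\in[0,+\infty]$. For $\overline M\ge0$, $\overline S(\overline M)$ is the set of densities $t$ which are bounded, supported on a compact interval $[a,b]$ (with $a<b$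 depending on $t$), non-increasing on $(a,b)$, and satisfy $M(t)=(b-a)V^2_{[a,b]}(\sqrt t)\le\overline M$. $\rho$-estimators. Let $\psi(u)=\frac{u-1}{\sqrt{1+u^2}}$ for $u\in[0,+\infty)$ and $\psi(+\infty)=1$. For densities $t,t'$ put $$\mathbf T(\boldsymbol X,t,t')=\frac n2\left[h^2\left(t,\tfrac{t+t'}2\right)-h^2\left(t',\tfrac{t+t'}2\right)\right]+\frac1{\sqrt2}\sum_{i=1}^n\psi\left(\sqrt{\tfrac{t'}{t}(X_i)}\right),$$ with the conventions $0/0=1$ and $a/0=+\infty$ for $a>0$. Given an at most countable subset $S$ of $\overline S$ which is dense in $\overline S$ for the Hellinger distance, let $\boldsymbol\Upsilon(S,t)=\sup_{t'\in S}\mathbf T(\boldsymbol X,t,t')$. A $\rho$-estimator on $\overline S$ is any (measurable) element $\widehat s$ of the closure (for $h$) of $\{t\in S:\ \boldsymbol\Upsilon(S,t)\le\inf_{t'\in S}\boldsymbol\Upsilon(S,t')+35.7\}$. *)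

theory Defs
  imports "HOL-Probability.Probability"
begin

text \<open>Densities are Borel functions, not classes modulo almost-everywhere equality, so the
  Hellinger distance below is a pseudo-distance on \<open>densities\<close>.\<close>

definition densities :: "(real \<Rightarrow> real) set" where
  "densities = {t \<in> borel_measurable lborel. (\<forall>x. 0 \<le> t x) \<and> (\<integral>\<^sup>+x. ennreal (t x) \<partial>lborel) = 1}"

definition hellinger :: "(real \<Rightarrow> real) \<Rightarrow> (real \<Rightarrow> real) \<Rightarrow> real" where
  "hellinger t u = sqrt (1 / 2 * (\<integral>x. (sqrt (t x) - sqrt (u x))\<^sup>2 \<partial>lborel))"

definition hellinger_set :: "(real \<Rightarrow> real) \<Rightarrow> (real \<Rightarrow> real) set \<Rightarrow> real" where
  "hellinger_set t A = (INF u\<in>A. hellinger t u)"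

definition hellinger_closure :: "(real \<Rightarrow> real) set \<Rightarrow> (real \<Rightarrow> real) set" where
  "hellinger_closure A = {t \<in> densities. \<forall>e>0. \<exists>u\<in>A. hellinger t u < e}"

definition hellinger_open :: "(real \<Rightarrow> real) set \<Rightarrow> bool" where
  "hellinger_open U \<longleftrightarrow>
     U \<subseteq> densities \<and> (\<forall>t\<in>U. \<exists>e>0. \<forall>u\<in>densities. hellinger t u < e \<longrightarrow> u \<in> U)"

definition hellinger_borel :: "(real \<Rightarrow> real) measure" where
  "hellinger_borel = sigma densities {U. hellinger_open U}"

definition variation_on :: "real set \<Rightarrow> (real \<Rightarrow> real) \<Rightarrow> ereal" where
  "variation_on I f = (SUP x\<in>interior I. ereal (f x)) - (INF x\<in>interior I. ereal (f x))"

definition decreasing_densities :: "(real \<Rightarrow> real) set" where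
  "decreasing_densities =
     {t \<in> densities. \<exists>xbar f. (\<forall>x\<in>{xbar<..}. 0 \<le> f x) \<and> antimono_on {xbar<..} f \<and>
        (\<integral>\<^sup>+x\<in>{xbar<..}. ennreal (f x) \<partial>lborel) = 1 \<and>
        t = (\<lambda>x. f x * indicator {xbar<..} x)}"

definition bounded_decreasing_densities :: "real \<Rightarrow> (real \<Rightarrow> real) set" where
  "bounded_decreasing_densities Mbar =
     {t \<in> densities. bounded (range t) \<and>
        (\<exists>a b. a < b \<and> (\<forall>x. x \<notin> {a..b} \<longrightarrow> t x = 0) \<and> antimono_on {a<..<b} t \<and>
          ereal (b - a) * (variation_on {a..b} (\<lambda>x. sqrt (t x)))\<^sup>2 \<le> ereal Mbar)}"

definition rho_psi :: "ereal \<Rightarrow> real" where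
  "rho_psi u = (if u = \<infinity> then 1
     else (real_of_ereal u - 1) / sqrt (1 + (real_of_ereal u)\<^sup>2))"

text \<open>The square root of \<open>a / b\<close> for \<open>a, b \<ge> 0\<close>, with \<open>0 / 0 = 1\<close> and \<open>a / 0 = \<infinity>\<close> for \<open>a > 0\<close>.\<close>

definition sqrt_ratio :: "real \<Rightarrow> real \<Rightarrow> ereal" where
  "sqrt_ratio a b =
     (if b = 0 then (if a = 0 then 1 else \<infinity>) else ereal (sqrt (a / b)))"

definition rho_T :: "nat \<Rightarrow> (nat \<Rightarrow> real) \<Rightarrow> (real \<Rightarrow> real) \<Rightarrow> (real \<Rightarrow> real) \<Rightarrow> real" where
  "rho_T n X t t' =
     real n / 2 * ((hellinger t (\<lambda>x. (t x + t' x) / 2))\<^sup>2 -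
                   (hellinger t' (\<lambda>x. (t x + t' x) / 2))\<^sup>2) +
     1 / sqrt 2 * (\<Sum>i=1..n. rho_psi (sqrt_ratio (t' (X i)) (t (X i))))"

text \<open>On densities \<open>rho_T n X\<close> is bounded in absolute value by \<open>n / 2 + n / sqrt 2\<close>, so the real
  supremum and infimum below are the genuine ones whenever \<open>S\<close> is a nonempty set of densities.\<close>

definition rho_Upsilon :: "nat \<Rightarrow> (nat \<Rightarrow> real) \<Rightarrow> (real \<Rightarrow> real) set \<Rightarrow> (real \<Rightarrow> real) \<Rightarrow> real" where
  "rho_Upsilon n X S t = (SUP t'\<in>S. rho_T n X t t')"

definition rho_estimator ::
  "nat \<Rightarrow> (real \<Rightarrow> real) set \<Rightarrow> ((nat \<Rightarrow> real) \<Rightarrow> real \<Rightarrow> real) \<Rightarrow> bool" where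
  "rho_estimator n Sbar shat \<longleftrightarrow>
     (\<exists>S. countable S \<and> S \<subseteq> Sbar \<and> Sbar \<subseteq> hellinger_closure S \<and>
        shat \<in> (\<Pi>\<^sub>M i\<in>{1..n}. borel) \<rightarrow>\<^sub>M hellinger_borel \<and>
        (\<forall>X\<in>space (\<Pi>\<^sub>M i\<in>{1..n}. borel).
           shat X \<in> hellinger_closure
             {t \<in> S. rho_Upsilon n X S t \<le> (INF t'\<in>S. rho_Upsilon n X S t') + 35.7}))"

end

theory Submission
  imports Defs
begin

text \<open>
  For a step density \<open>sb\<close> with \<open>k\<close> pieces, \<open>score (sb x) (t' x)\<close> is, for decreasing \<open>t'\<close>,
  antitone on each of at most \<open>2 k\<close> intervals, so its level sets are unions of \<open>2 k\<close> intervals.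
  A Chernoff bound on a grid of quantile intervals controls all intervals at once; weighting the
  deviations of the level set at height \<open>y\<close> proportionally to \<open>y\<close> and summing over the heights bounds
  the centred sum of scores by a small multiple of \<open>n\<close> times its second moment plus
  \<open>O(k (log n)\<^sup>2)\<close>. This replaces VC and chaining arguments at the cost of logarithms only.
  The second moment is absorbed by the negative drift of the test statistic. A bounded decreasing
  density in \<open>bounded_decreasing_densities M\<close> is within squared distance \<open>M / D\<^sup>2\<close> of a step density
  with \<open>D + 3\<close> pieces, and \<open>D\<close> of order \<open>(n M) powr (1 / 3)\<close> balances both errors.
\<close>

section \<open>Uniform deviations over intervals\<close>

text \<open>The estimator is defined by a minimax over \<open>S\<close>, yet an upper bound on
  \<open>rho_T n X sb t'\<close> uniform in \<open>t'\<close> suffices. As \<open>rho_T\<close> is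
  antisymmetric, this bound caps \<open>rho_Upsilon\<close> near \<open>sb\<close>, hence the
  minimum over \<open>S\<close>, and also bounds \<open>rho_T n X w sb\<close> from below for a
  near-minimiser \<open>w\<close> far from \<open>s\<close>. With \<open>sb\<close> fixed and
  constant on each piece, monotonicity of \<open>score\<close> in its second argument is all that is
  needed to find intervals; this is why the comparison point is a step density and not the bounded
  decreasing density itself.

  Per observation the drift leaves \<open>(1 - sqrt 2 / 2) * (hellinger s t')^2\<close>, about 0.29
  times the squared distance, while the second moment is at most 6 times the sum of two squared
  distances; the slope 1/32 makes the former win. One logarithm comes from the union bound
  (\<open>L\<close> is \<open>4 * ln n\<close>), the other from a harmonic sum: the additive
  Chernoff cost at height \<open>y\<close> is of order \<open>L / y\<close>. The pieces present
  whatever \<open>M\<close> is cost order \<open>(ln n)^2 / n\<close>, which the second entry of the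
  maximum covers.\<close>

lemma exp_le_quadratic:
  fixes x :: real
  assumes "\<bar>x\<bar> \<le> 1"
  shows "exp x \<le> 1 + x + x\<^sup>2"
proof (cases "0 \<le> x")
  case True
  then show ?thesis using exp_bound[of x] assms by simp
next
  case False
  define y where "y = - x"
  have y: "0 < y" "y \<le> 1" using False assms by (auto simp: y_def)
  \<comment> \<open>The product equals \<open>1 + y ^ 3\<close>.\<close>
  have "1 \<le> (1 + y) * (1 - y + y\<^sup>2)"
    using y by (simp add: algebra_simps power2_eq_square power3_eq_cube)
  also have "\<dots> \<le> exp y * (1 - y + y\<^sup>2)"
    using y exp_ge_add_one_self[of y] by (intro mult_right_mono) (simp_all add: add_increasing2)
  finally have "exp (- y) \<le> 1 - y + y\<^sup>2"
    by (simp add: exp_minus divide_simps mult.commute)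
  then show ?thesis by (simp add: y_def)
qed

lemma harm_le_ln: "0 < n \<Longrightarrow> harm n \<le> 1 + ln (real n)"
  using decseqD[OF decseq_harm_diff_ln, of 0 "n - 1"] by (simp add: harm_def)

text \<open>Everything is governed by the number \<open>m\<close> of positive integers below
  \<open>w\<close>: \<open>m \<le> w \<le> m + 1\<close>, and
  \<open>1 + ... + m = m (m + 1) / 2\<close> is at most \<open>m^2\<close>, also for
  \<open>m = 0\<close>.\<close>

lemma sum_less_bounds:
  fixes w :: real and n :: nat
  assumes "0 \<le> w" "w \<le> n"
  shows "(\<Sum>k=1..n. of_bool (k < w)) \<le> w"
    and "w \<le> (\<Sum>k=1..n. of_bool (k < w)) + 1"
    and "(\<Sum>k=1..n. k * of_bool (k < w)) \<le> w\<^sup>2"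
proof -
  define m where "m = nat (\<lceil>w\<rceil> - 1)"
  have eq: "{1..n} \<inter> {k. real k < w} = {1..m}"
  proof (rule set_eqI)
    fix k :: nat
    have "real k < w \<longleftrightarrow> int k < \<lceil>w\<rceil>" by (simp add: less_ceiling_iff)
    moreover have "\<lceil>w\<rceil> \<le> n" using assms by (simp add: ceiling_le_iff)
    ultimately show "k \<in> {1..n} \<inter> {k. real k < w} \<longleftrightarrow> k \<in> {1..m}" by (auto simp: m_def)
  qed
  have m: "m \<le> w" "w \<le> m + 1" using assms unfolding m_def by linarith+
  have 1: "(\<Sum>k=1..n. of_bool (k < w)) = real m"
    using eq by (simp add: of_bool_def sum.If_cases)
  show "(\<Sum>k=1..n. of_bool (k < w)) \<le> w" "w \<le> (\<Sum>k=1..n. of_bool (k < w)) + 1"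
    unfolding 1 using m by auto
  have "(\<Sum>k=1..n. k * of_bool (k < w)) = (\<Sum>k=1..m. real k)"
    unfolding eq[symmetric] by (simp add: of_bool_def sum.If_cases if_distrib[of "\<lambda>x. _ * x"] cong: if_cong)
  also have "2 * \<dots> = real m * (real m + 1)"
    by (induction m) (auto simp: algebra_simps)
  also have "\<dots> \<le> 2 * (real m)\<^sup>2"
    by (cases m) (auto simp: power2_eq_square algebra_simps)
  also have "\<dots> \<le> 2 * w\<^sup>2" using m by (intro mult_left_mono power_mono) auto
  finally show "(\<Sum>k=1..n. k * of_bool (k < w)) \<le> w\<^sup>2" by simp
qed

text \<open>A discrete layer-cake formula. By the third bound, deviations proportional to the height of the
  layer add up to a multiple of \<open>v\<^sup>2\<close>.\<close>

lemma layer_bounds: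
  fixes v :: real and n :: nat
  assumes v: "\<bar>v\<bar> \<le> 1" and n: "0 < n"
  defines "c \<equiv> (\<Sum>k=1..n. of_bool (k / n < v) - of_bool (v < - (k / n)) :: real)"
  shows "v \<le> c / n + 1 / n" and "c / n - 1 / n \<le> v"
    and "(\<Sum>k=1..n. k / n * (of_bool (k / n < v) + of_bool (v < - (k / n)))) \<le> n * v\<^sup>2"
proof -
  have ip: "real k / n < v \<longleftrightarrow> k < n * v" and im: "v < - (real k / n) \<longleftrightarrow> k < n * (- v)" for k
    using n by (auto simp: field_simps)
  have "n * v \<le> c + 1 \<and> c - 1 \<le> n * v
    \<and> (\<Sum>k=1..n. k * (of_bool (k / n < v) + of_bool (v < - (k / n)))) \<le> (n * v)\<^sup>2"
  \<comment> \<open>Only layers with the sign of \<open>v\<close> are nonempty, so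
    \<open>sum_less_bounds\<close> applies at \<open>n * \<bar>v\<bar>\<close>.\<close>
  proof (cases "0 \<le> v")
    case True
    then have "\<not> real k < n * (- v)" for k by (simp add: not_less order_trans[of _ 0])
    moreover have "0 \<le> n * v" "n * v \<le> n" using True v n by (auto simp: mult_left_le)
    ultimately show ?thesis
      using sum_less_bounds[of "n * v" n] unfolding c_def ip im by simp
  next
    case False
    then have "\<not> real k < n * v" for k
      by (simp add: not_less order_trans[of _ 0] mult_nonneg_nonpos)
    moreover have "0 \<le> n * (- v)" "n * (- v) \<le> n" using False v n by (auto intro: mult_nonneg_nonpos mult_left_le[of "- v" "real n", simplified])
    ultimately show ?thesis
      using sum_less_bounds[of "n * (- v)" n] unfolding c_def ip im by (simp add: sum_negf)
  qed
  then have *: "n * v \<le> c + 1" "c - 1 \<le> n * v"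
    "(\<Sum>k=1..n. k * (of_bool (k / n < v) + of_bool (v < - (k / n)))) \<le> (n * v)\<^sup>2" by auto
  show "v \<le> c / n + 1 / n" "c / n - 1 / n \<le> v"
    using * n by (auto simp: field_simps)
  have "(\<Sum>k=1..n. k / n * (of_bool (k / n < v) + of_bool (v < - (k / n))))
    = (\<Sum>k=1..n. k * (of_bool (k / n < v) + of_bool (v < - (k / n)))) / n"
    by (simp add: sum_divide_distrib)
  also have "\<dots> \<le> (n * v)\<^sup>2 / n" using * by (intro divide_right_mono) auto
  also have "\<dots> = n * v\<^sup>2" using n by (simp add: power2_eq_square)
  finally show "(\<Sum>k=1..n. k / n * (of_bool (k / n < v) + of_bool (v < - (k / n)))) \<le> n * v\<^sup>2" .
qed

section \<open>Atomless distributions on the line and deviations of counts from their means\<close>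

context real_distribution
begin

lemma measurable_cdf [measurable]: "cdf M \<in> borel_measurable borel"
  by (intro borel_measurable_mono monoI cdf_nondecreasing)

text \<open>Probability integral transform: without atoms the cdf is continuous, so a nonempty level
  set with \<open>u < 1\<close> is a closed half-line \<open>{..q}\<close> and
  \<open>cdf M q = u\<close>.\<close>

lemma prob_cdf_le:
  assumes atomless: "\<And>x. prob {x} = 0" and u: "0 \<le> u" "u \<le> 1"
  shows "prob {x. cdf M x \<le> u} = u"
proof -
  have cont: "isCont (cdf M) x" for x
    using atomless by (simp add: isCont_cdf)
  let ?S = "{x. cdf M x \<le> u}"
  consider "u = 1" | "u < 1" "?S = {}" | "u < 1" "?S \<noteq> {}" using u by linarith
  then show ?thesis
  proof cases
    case 1
    then have "?S = UNIV" using cdf_bounded_prob by auto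
    then show ?thesis using prob_space 1 by simp
  next
    case 2
    have "u = 0"
    proof (rule ccontr)
      assume "u \<noteq> 0"
      then have "eventually (\<lambda>x. cdf M x < u) at_bot"
        using u order_tendstoD(2)[OF cdf_lim_at_bot] by auto
      then have "\<exists>x. cdf M x < u" by (auto simp: eventually_at_bot_linorder)
      then show False using 2 by (auto dest: less_imp_le)
    qed
    then show ?thesis using 2 by simp
  next
    case 3
    have "eventually (\<lambda>x. u < cdf M x) at_top"
      using 3 order_tendstoD(1)[OF cdf_lim_at_top_prob] by auto
    then obtain N where N: "\<And>x. N \<le> x \<Longrightarrow> u < cdf M x"
      by (auto simp: eventually_at_top_linorder)
    have bdd: "bdd_above ?S"
      using N by (intro bdd_aboveI[of _ N]) (force simp: not_less[symmetric])
    have "closed ?S"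
      using cont by (intro closed_Collect_le continuous_at_imp_continuous_on) auto
    define q where "q = Sup ?S"
    have q: "cdf M q \<le> u"
      using closed_contains_Sup[OF 3(2) bdd \<open>closed ?S\<close>] by (simp add: q_def)
    have eq: "?S = {..q}"
      using cSup_upper[OF _ bdd] q by (auto simp: q_def intro: order_trans[OF cdf_nondecreasing])
    \<comment> \<open>Otherwise right continuity would put points beyond \<open>q\<close> into the
      level set.\<close>
    have "\<not> cdf M q < u"
    proof
      assume "cdf M q < u"
      then have "eventually (\<lambda>x. cdf M x < u) (at_right q)"
        using cdf_is_right_cont[of q] order_tendstoD(2)[of "cdf M" "cdf M q" "at_right q" u]
        by (simp add: continuous_within)
      then obtain b where "q < b" "\<And>x. q < x \<Longrightarrow> x < b \<Longrightarrow> cdf M x < u"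
        by (auto simp: eventually_at_right_field)
      then have "(q + b) / 2 \<in> ?S" by (auto intro!: less_imp_le)
      then show False using eq \<open>q < b\<close> by auto
    qed
    then show ?thesis using q eq by (simp add: cdf_def)
  qed
qed

lemma prob_cdf_less:
  assumes atomless: "\<And>x. prob {x} = 0" and u: "0 \<le> u" "u \<le> 1"
  shows "prob {x. cdf M x < u} = u"
proof (rule antisym)
  have "prob {x. cdf M x < u} \<le> prob {x. cdf M x \<le> u}"
    by (intro finite_measure_mono) auto
  then show "prob {x. cdf M x < u} \<le> u" using prob_cdf_le[OF assms] by simp
  show "u \<le> prob {x. cdf M x < u}"
  proof (rule dense_le)
    fix v assume "v < u"
    show "v \<le> prob {x. cdf M x < u}"
    proof (cases "0 \<le> v")
      case True
      have "prob {x. cdf M x \<le> v} \<le> prob {x. cdf M x < u}"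
        using \<open>v < u\<close> by (intro finite_measure_mono) auto
      then show ?thesis using prob_cdf_le[OF atomless True] u \<open>v < u\<close> by simp
    next
      case False
      then show ?thesis using measure_nonneg[of M] by (meson le_less_linear less_le_trans order.trans less_imp_le)
    qed
  qed
qed

lemma prob_cdf_Icc:
  assumes atomless: "\<And>x. prob {x} = 0" and "0 \<le> u" "u \<le> v" "v \<le> 1"
  shows "prob {x. u \<le> cdf M x \<and> cdf M x \<le> v} = v - u"
proof -
  have "{x. u \<le> cdf M x \<and> cdf M x \<le> v} = {x. cdf M x \<le> v} - {x. cdf M x < u}" by auto
  moreover have "prob ({x. cdf M x \<le> v} - {x. cdf M x < u}) = prob {x. cdf M x \<le> v} - prob {x. cdf M x < u}"
    using assms by (intro finite_measure_Diff) auto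
  ultimately show ?thesis using prob_cdf_le[OF atomless, of v] prob_cdf_less[OF atomless, of u] assms by simp
qed

lemma prob_cdf_Ioo:
  assumes atomless: "\<And>x. prob {x} = 0" and "0 \<le> u" "u \<le> v" "v \<le> 1"
  shows "prob {x. u < cdf M x \<and> cdf M x < v} = v - u"
proof (cases "u = v")
  case False
  have "{x. u < cdf M x \<and> cdf M x < v} = {x. cdf M x < v} - {x. cdf M x \<le> u}" by auto
  moreover have "prob ({x. cdf M x < v} - {x. cdf M x \<le> u}) = prob {x. cdf M x < v} - prob {x. cdf M x \<le> u}"
    using assms False by (intro finite_measure_Diff) auto
  ultimately show ?thesis using prob_cdf_le[OF atomless, of u] prob_cdf_less[OF atomless, of v] assms by simp
next
  case True
  then have *: "{x. u < cdf M x \<and> cdf M x < v} = {}" by auto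
  show ?thesis unfolding * using True by simp
qed

text \<open>Moment generating function of a centred Bernoulli variable, by
  \<open>exp l - 1 \<le> l + l^2\<close> and \<open>1 + x \<le> exp x\<close>. The factor
  \<open>prob A\<close> kept in the exponent is what lets deviations scale with a second moment
  later; a Hoeffding bound would lose it.\<close>

lemma nn_integral_exp_indicator_le:
  assumes [measurable]: "A \<in> sets borel" and l: "\<bar>l\<bar> \<le> 1"
  shows "(\<integral>\<^sup>+x. ennreal (exp (l * (indicator A x - prob A))) \<partial>M) \<le> ennreal (exp (l\<^sup>2 * prob A))"
proof -
  let ?p = "prob A"
  have int: "integrable M (\<lambda>x. indicator A x :: real)"
    by (intro integrable_real_indicator) (auto simp: emeasure_eq_measure)
  have eq: "exp (l * (indicator A x - ?p)) = exp (- l * ?p) * (1 + (exp l - 1) * indicator A x)" for x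
    by (auto simp: indicator_def exp_add[symmetric] algebra_simps)
  have "(\<integral>\<^sup>+x. ennreal (exp (l * (indicator A x - ?p))) \<partial>M) = ennreal (\<integral>x. exp (l * (indicator A x - ?p)) \<partial>M)"
    unfolding eq using int
    by (intro nn_integral_eq_integral Bochner_Integration.integrable_mult_right Bochner_Integration.integrable_add integrable_const)
       (auto simp: indicator_def)
  also have "(\<integral>x. exp (l * (indicator A x - ?p)) \<partial>M) = exp (- l * ?p) * (1 + (exp l - 1) * ?p)"
    unfolding eq using int
    by (subst integral_mult_right_zero, subst Bochner_Integration.integral_add) (auto simp: prob_space[simplified])
  also have "\<dots> \<le> exp (- l * ?p) * exp ((l + l\<^sup>2) * ?p)"
  proof (intro mult_left_mono)
    have "1 + (exp l - 1) * ?p \<le> 1 + (l + l\<^sup>2) * ?p"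
      using exp_le_quadratic[OF l] by (intro add_left_mono mult_right_mono) auto
    also have "\<dots> \<le> exp ((l + l\<^sup>2) * ?p)" by (rule exp_ge_add_one_self)
    finally show "1 + (exp l - 1) * ?p \<le> exp ((l + l\<^sup>2) * ?p)" .
  qed auto
  also have "\<dots> = exp (l\<^sup>2 * ?p)"
    by (simp add: exp_add[symmetric] algebra_simps)
  finally show ?thesis by (simp add: ennreal_leI)
qed

text \<open>Markov's inequality for the exponential of the centred count, whose expectation
  factorises under the product measure. Both signs of \<open>l\<close> are allowed, so upper and
  lower tails are covered together.\<close>

lemma prob_count_deviation:
  fixes n :: nat
  defines "P \<equiv> Pi\<^sub>M {1..n} (\<lambda>i. M)"
  assumes [measurable]: "A \<in> sets borel" and l: "\<bar>l\<bar> \<le> 1"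
  shows "measure P {X \<in> space P. l\<^sup>2 * (n * prob A) + L < l * ((\<Sum>i=1..n. indicator A (X i)) - n * prob A)}
    \<le> exp (- L)"
proof -
  interpret product_sigma_finite "\<lambda>i. M" ..
  interpret pr: prob_space P unfolding P_def by (rule prob_space_PiM) (rule prob_space_axioms)
  let ?q = "l\<^sup>2 * (n * prob A)"
  let ?B = "{X \<in> space P. ?q + L < l * ((\<Sum>i=1..n. indicator A (X i)) - n * prob A)}"
  let ?f = "\<lambda>x. ennreal (exp (l * (indicator A x - prob A)))"
  have meas[measurable]: "?f \<in> borel_measurable M" by measurable
  have expeq: "(\<Prod>i=1..n. ?f (X i)) = ennreal (exp (l * ((\<Sum>i=1..n. indicator A (X i)) - n * prob A)))" for X
    by (simp add: prod_ennreal exp_sum[symmetric] sum_distrib_left[symmetric] sum_subtractf)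
  have B[measurable]: "?B \<in> sets P" unfolding P_def by measurable
  have "ennreal (exp (?q + L)) * emeasure P ?B = (\<integral>\<^sup>+X. ennreal (exp (?q + L)) * indicator ?B X \<partial>P)"
    by (rule nn_integral_cmult_indicator[OF B, symmetric])
  also have "\<dots> \<le> (\<integral>\<^sup>+X. (\<Prod>i=1..n. ?f (X i)) \<partial>P)"
    unfolding expeq by (intro nn_integral_mono) (auto split: split_indicator intro!: ennreal_leI)
  also have "\<dots> = (\<Prod>i=1..n. \<integral>\<^sup>+x. ?f x \<partial>M)"
    unfolding P_def by (rule product_nn_integral_prod) auto
  also have "\<dots> \<le> (\<Prod>i=1..n. ennreal (exp (l\<^sup>2 * prob A)))"
    using nn_integral_exp_indicator_le[OF assms(2) l] by (intro prod_mono_ennreal) auto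
  also have "\<dots> = ennreal (exp ?q)"
    by (simp add: ennreal_power exp_of_nat_mult[symmetric] mult_ac)
  finally have "ennreal (exp (?q + L) * pr.prob ?B) \<le> ennreal (exp ?q)"
    by (simp add: pr.emeasure_eq_measure ennreal_mult)
  then have "exp (?q + L) * pr.prob ?B \<le> exp ?q"
    by (simp)
  then show ?thesis
    by (simp add: exp_add exp_minus divide_simps mult.commute)
qed

text \<open>The grid lives on the values of the cdf, so no quantile function is required and flat
  stretches of the cdf cause no ambiguity. Cells with \<open>k < j\<close> are empty.\<close>

definition cdf_cell :: "nat \<Rightarrow> int \<Rightarrow> int \<Rightarrow> real set" where
  "cdf_cell n j k = {x. of_int j \<le> n * cdf M x \<and> n * cdf M x \<le> of_int k}"

lemma cdf_cell_borel [measurable]: "cdf_cell n j k \<in> sets borel"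
  unfolding cdf_cell_def by measurable

text \<open>The slope \<open>e * m / n\<close> is the Chernoff parameter reserved for the layer at
  height \<open>m / n\<close>. Indices run past 0 and \<open>n\<close> because inner approximations
  of an interval drop one more cell at each end.\<close>

definition regular_sample :: "nat \<Rightarrow> real \<Rightarrow> real \<Rightarrow> (nat \<Rightarrow> real) \<Rightarrow> bool" where
  "regular_sample n e L X \<longleftrightarrow>
     (\<forall>j\<in>{-1..int n + 1}. \<forall>k\<in>{-1..int n + 1}. \<forall>m\<in>{1..n}.
        \<bar>(\<Sum>i=1..n. indicator (cdf_cell n j k) (X i)) - n * prob (cdf_cell n j k)\<bar>
        \<le> e * real m / n * (n * prob (cdf_cell n j k)) + L / (e * real m / n))"

text \<open>Union bound over \<open>(n + 3)^2\<close> cells, \<open>n\<close> slopes and two signs;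
  \<open>n + 3 \<le> 2 * n\<close> turns the count into \<open>8 * n ^ 3\<close>.\<close>

lemma prob_not_regular_sample:
  fixes n :: nat
  defines "P \<equiv> Pi\<^sub>M {1..n} (\<lambda>i. M)"
  assumes e: "0 < e" "e \<le> 1" and n: "3 \<le> n"
  shows "{X \<in> space P. \<not> regular_sample n e L X} \<in> sets P"
    and "measure P {X \<in> space P. \<not> regular_sample n e L X} \<le> 8 * real n ^ 3 * exp (- L)"
proof -
  interpret pr: prob_space P unfolding P_def by (rule prob_space_PiM) (rule prob_space_axioms)
  let ?J = "{-1..int n + 1} \<times> {-1..int n + 1} \<times> {1..n} \<times> {-1, 1::real}"
  define B where "B = (\<lambda>(j, k, m, s). {X \<in> space P.
    (s * (e * real m / n))\<^sup>2 * (n * prob (cdf_cell n j k)) + L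
    < s * (e * real m / n) * ((\<Sum>i=1..n. indicator (cdf_cell n j k) (X i)) - n * prob (cdf_cell n j k))})"
  have B[measurable]: "B p \<in> sets P" for p
    unfolding B_def P_def by (cases p) simp
  have l: "0 < e * real m / n" "e * real m / n \<le> 1" if "m \<in> {1..n}" for m
    using that e n mult_mono[of e 1 "real m" "real n"] by (auto simp: divide_simps)
  \<comment> \<open>Dividing the Chernoff event by \<open>l\<close> trades the quadratic form of its
    exponent for the slope form used in \<open>regular_sample\<close>; the sign \<open>s\<close>
    selects the tail.\<close>
  have abs_iff: "(l * Q + L / l < \<bar>D\<bar>) \<longleftrightarrow> (\<exists>s\<in>{-1, 1}. (s * l)\<^sup>2 * Q + L < s * l * D)"
    if "0 < l" for l Q D :: real
  proof -
    have "l * Q + L / l < \<bar>D\<bar> \<longleftrightarrow> l * (l * Q + L / l) < l * \<bar>D\<bar>"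
      using that by simp
    also have "l * (l * Q + L / l) = l\<^sup>2 * Q + L"
      using that by (simp add: field_simps power2_eq_square)
    also have "l * \<bar>D\<bar> = \<bar>l * D\<bar>" using that by (simp add: abs_mult)
    finally show ?thesis by (auto simp: abs_if split: if_splits)
  qed
  have eq: "{X \<in> space P. \<not> regular_sample n e L X} = (\<Union>p\<in>?J. B p)"
  proof (rule set_eqI)
    fix X
    show "X \<in> {X \<in> space P. \<not> regular_sample n e L X} \<longleftrightarrow> X \<in> (\<Union>p\<in>?J. B p)"
    proof
      assume "X \<in> {X \<in> space P. \<not> regular_sample n e L X}"
      then obtain j k m where *: "X \<in> space P" "j \<in> {-1..int n + 1}" "k \<in> {-1..int n + 1}" "m \<in> {1..n}"
        and "\<not> \<bar>(\<Sum>i=1..n. indicator (cdf_cell n j k) (X i)) - n * prob (cdf_cell n j k)\<bar>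
          \<le> e * real m / n * (n * prob (cdf_cell n j k)) + L / (e * real m / n)"
        unfolding regular_sample_def by blast
      then obtain s where "s \<in> {-1, 1::real}" "X \<in> B (j, k, m, s)"
        using abs_iff[OF l(1)[OF *(4)]] by (auto simp only: B_def mem_Collect_eq prod.case not_le)
      with * show "X \<in> (\<Union>p\<in>?J. B p)" by blast
    next
      assume "X \<in> (\<Union>p\<in>?J. B p)"
      then obtain j k m s where *: "j \<in> {-1..int n + 1}" "k \<in> {-1..int n + 1}" "m \<in> {1..n}"
        and s: "s \<in> {-1, 1::real}" "X \<in> B (j, k, m, s)" by blast
      then have "\<not> \<bar>(\<Sum>i=1..n. indicator (cdf_cell n j k) (X i)) - n * prob (cdf_cell n j k)\<bar>
          \<le> e * real m / n * (n * prob (cdf_cell n j k)) + L / (e * real m / n)"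
        unfolding not_le using abs_iff[OF l(1)[OF *(3)]] by (auto simp only: B_def mem_Collect_eq prod.case)
      moreover have "X \<in> space P" using s by (auto simp: B_def)
      ultimately show "X \<in> {X \<in> space P. \<not> regular_sample n e L X}"
        using * unfolding regular_sample_def by blast
    qed
  qed
  show "{X \<in> space P. \<not> regular_sample n e L X} \<in> sets P" unfolding eq by auto
  have "measure P (\<Union>p\<in>?J. B p) \<le> (\<Sum>p\<in>?J. measure P (B p))"
    by (intro pr.finite_measure_subadditive_finite) auto
  also have "\<dots> \<le> (\<Sum>p\<in>?J. exp (- L))"
  proof (rule sum_mono)
    fix p assume "p \<in> ?J"
    then obtain j k m s where p: "p = (j, k, m, s)" and m: "m \<in> {1..n}" and s: "s \<in> {-1, 1::real}"
      by blast
    have "\<bar>s * (e * real m / n)\<bar> \<le> 1" using l[OF m] s by auto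
    then show "measure P (B p) \<le> exp (- L)"
      unfolding B_def p P_def prod.case by (intro prob_count_deviation) auto
  qed
  also have "\<dots> = (real n + 3)\<^sup>2 * real n * 2 * exp (- L)"
    by (simp add: card_cartesian_product power2_eq_square nat_add_distrib algebra_simps)
  also have "\<dots> \<le> (2 * real n)\<^sup>2 * real n * 2 * exp (- L)"
    using n by (intro mult_right_mono power_mono) auto
  also have "\<dots> = 8 * real n ^ 3 * exp (- L)" by (simp add: power2_eq_square power3_eq_cube)
  finally show "measure P {X \<in> space P. \<not> regular_sample n e L X} \<le> 8 * real n ^ 3 * exp (- L)"
    unfolding eq .
qed

text \<open>Sandwich between grid cells. The outer cell exceeds \<open>n * prob I\<close> by at most
  2, which costs \<open>2 + 2 * l \<le> 4\<close>; the inner cell falls short by at most 4.\<close>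

lemma regular_sample_interval:
  fixes n :: nat
  assumes atomless: "\<And>x. prob {x} = 0" and reg: "regular_sample n e L X"
    and e: "0 < e" "e \<le> 1" and L: "0 \<le> L" and m: "m \<in> {1..n}"
    and I: "is_interval I"
  defines "l \<equiv> e * real m / n"
  shows "\<bar>(\<Sum>i=1..n. indicator I (X i)) - n * prob I\<bar> \<le> l * (n * prob I) + L / l + 4"
proof -
  have l: "0 < l" "l \<le> 1"
    using m e mult_mono[of e 1 "real m" "real n"] by (auto simp: l_def divide_simps)
  have n: "0 < n" using m by auto
  have [measurable]: "I \<in> sets borel" by (rule real_interval_borel_measurable[OF I])
  show ?thesis
  proof (cases "I = {}")
    case True
    then show ?thesis using l L by simp
  next
    case False
    let ?F = "cdf M"
    \<comment> \<open>The range of the cdf over \<open>I\<close> replaces the endpoints of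
      \<open>I\<close>, so open, closed and unbounded intervals need no separate treatment.\<close>
    define a where "a = Inf (?F ` I)"
    define b where "b = Sup (?F ` I)"
    have bdd: "bdd_below (?F ` I)" "bdd_above (?F ` I)"
      using cdf_nonneg cdf_bounded_prob by (auto intro!: bdd_belowI2 bdd_aboveI2)
    have ab: "a \<le> ?F x" "?F x \<le> b" if "x \<in> I" for x
      using that bdd by (auto simp: a_def b_def intro: cINF_lower cSUP_upper)
    have a0: "0 \<le> a" using False cdf_nonneg by (auto simp: a_def intro: cINF_greatest)
    have b1: "b \<le> 1" using False cdf_bounded_prob by (auto simp: b_def intro: cSUP_least)
    have aleb: "a \<le> b" using ab False order_trans by blast
    have inner: "x \<in> I" if ax: "a < ?F x" and xb: "?F x < b" for x
    proof -
      obtain y where y: "y \<in> I" "?F y < ?F x"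
        using ax cINF_less_iff[OF False bdd(1), of "?F x"] unfolding a_def by blast
      obtain z where z: "z \<in> I" "?F x < ?F z"
        using xb less_cSUP_iff[OF False bdd(2), of "?F x"] unfolding b_def by blast
      have "y \<le> x" "x \<le> z"
        using y z cdf_nondecreasing by (meson le_less_linear less_imp_le not_less)+
      then show ?thesis using mem_is_interval_1_I[OF I] y z by blast
    qed
    have pI: "prob I = b - a"
    proof (rule antisym)
      have "prob I \<le> prob {x. a \<le> ?F x \<and> ?F x \<le> b}"
        using ab by (intro finite_measure_mono) auto
      then show "prob I \<le> b - a" using prob_cdf_Icc[OF atomless a0 aleb b1] by simp
      have "prob {x. a < ?F x \<and> ?F x < b} \<le> prob I"
        using inner by (intro finite_measure_mono) auto
      then show "b - a \<le> prob I" using prob_cdf_Ioo[OF atomless a0 aleb b1] by simp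
    qed
    have na: "0 \<le> n * a" "n * a \<le> n" "0 \<le> n * b" "n * b \<le> n" "n * a \<le> n * b"
      using a0 b1 aleb n by (auto simp: mult_left_le)
    have reg': "\<bar>(\<Sum>i=1..n. indicator (cdf_cell n j k) (X i)) - n * prob (cdf_cell n j k)\<bar>
        \<le> l * (n * prob (cdf_cell n j k)) + L / l"
      if "j \<in> {-1..int n + 1}" "k \<in> {-1..int n + 1}" for j k
      using reg that m unfolding regular_sample_def l_def by blast
    have cell: "cdf_cell n j k = {x. j / n \<le> ?F x \<and> ?F x \<le> k / n}" for j k
      using n by (auto simp: cdf_cell_def field_simps)
    let ?N = "\<lambda>A. (\<Sum>i=1..n. indicator A (X i)) :: real"
    have N_mono: "?N A \<le> ?N B" if "A \<subseteq> B" for A B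
      using that by (intro sum_mono) (auto simp: indicator_def)

    define j k where "j = \<lfloor>n * a\<rfloor>" and "k = \<lceil>n * b\<rceil>"
    have jk: "0 \<le> j" "j \<le> n" "0 \<le> k" "k \<le> n" "real_of_int j \<le> n * a" "n * a < j + 1"
        "n * b \<le> k" "k < n * b + 1"
      using na unfolding j_def k_def by linarith+
    have "I \<subseteq> cdf_cell n j k"
    proof
      fix x assume "x \<in> I"
      then have "n * a \<le> n * ?F x" "n * ?F x \<le> n * b" using ab by (auto intro: mult_left_mono)
      then show "x \<in> cdf_cell n j k" using jk by (auto simp: cdf_cell_def)
    qed
    moreover have "n * prob (cdf_cell n j k) = k - j"
    proof -
      have "real_of_int j / n \<le> k / n" using jk na by (intro divide_right_mono) auto
      then have "prob (cdf_cell n j k) = k / n - j / n"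
        unfolding cell using jk n by (intro prob_cdf_Icc[OF atomless]) (auto simp: divide_simps)
      then show ?thesis using n by (simp add: field_simps)
    qed
    ultimately have up: "?N I \<le> (k - j) + (l * (k - j) + L / l)"
      using reg'[of j k] jk N_mono[of I "cdf_cell n j k"] by (auto simp: abs_le_iff)
    have "k - j \<le> n * prob I + 2" using jk by (simp add: pI algebra_simps)
    then have "l * (k - j) \<le> l * (n * prob I) + 2 * l"
      using mult_left_mono[of "real_of_int (k - j)" "n * prob I + 2" l] l by (simp add: algebra_simps)
    with up \<open>k - j \<le> n * prob I + 2\<close> l have 1: "?N I - n * prob I \<le> l * (n * prob I) + L / l + 4"
      by (simp add: algebra_simps)

    \<comment> \<open>The extra unit at each end makes \<open>n * a < j'\<close> and
      \<open>k' < n * b\<close> strict, as \<open>inner\<close> demands.\<close>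
    define j' k' where "j' = \<lceil>n * a\<rceil> + 1" and "k' = \<lfloor>n * b\<rfloor> - 1"
    have jk': "1 \<le> j'" "j' \<le> int n + 1" "-1 \<le> k'" "k' \<le> int n - 1" "n * a < j'" "j' < n * a + 2"
        "k' < n * b" "n * b < k' + 2"
      using na unfolding j'_def k'_def by linarith+
    have sub: "cdf_cell n j' k' \<subseteq> I"
    proof
      fix x assume "x \<in> cdf_cell n j' k'"
      then have "n * a < n * ?F x" "n * ?F x < n * b"
        using jk' unfolding cdf_cell_def mem_Collect_eq by linarith+
      then show "x \<in> I" using n by (intro inner) auto
    qed
    have "k' - j' \<le> n * prob (cdf_cell n j' k')"
    proof (cases "j' \<le> k'")
      case True
      then have "real_of_int j' / n \<le> k' / n" using jk' na by (intro divide_right_mono) auto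
      then have "prob (cdf_cell n j' k') = k' / n - j' / n"
        unfolding cell using jk' n True by (intro prob_cdf_Icc[OF atomless]) (auto simp: divide_simps)
      then show ?thesis using n by (simp add: field_simps)
    next
      case False
      then have "real_of_int (k' - j') \<le> 0" by simp
      also have "\<dots> \<le> n * prob (cdf_cell n j' k')" by simp
      finally show ?thesis .
    qed
    moreover have "n * prob I \<le> k' - j' + 4" using jk' by (simp add: pI algebra_simps)
    moreover have "l * (n * prob (cdf_cell n j' k')) \<le> l * (n * prob I)"
      using l sub by (intro mult_left_mono finite_measure_mono) auto
    ultimately have "n * prob I - ?N I \<le> l * (n * prob I) + L / l + 4"
      using reg'[of j' k'] jk' N_mono[OF sub] by (auto simp: abs_le_iff)
    with 1 show ?thesis by (simp add: abs_le_iff)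
  qed
qed

text \<open>A labelling \<open>\<kappa>\<close> encodes the partition into pieces. The part of the
  deviation proportional to probability adds up to that of \<open>A\<close>; only the additive part
  is paid once per piece.\<close>

lemma regular_sample_pieces:
  fixes n :: nat and \<kappa> :: "real \<Rightarrow> 'b"
  assumes atomless: "\<And>x. prob {x} = 0" and reg: "regular_sample n e L X"
    and e: "0 < e" "e \<le> 1" and L: "0 \<le> L" and m: "m \<in> {1..n}"
    and fin: "finite (range \<kappa>)" and I: "\<And>c. is_interval {x \<in> A. \<kappa> x = c}"
  defines "l \<equiv> e * real m / n"
  shows "\<bar>(\<Sum>i=1..n. indicator A (X i)) - n * prob A\<bar>
    \<le> l * (n * prob A) + card (range \<kappa>) * (L / l + 4)"
proof -
  define B where "B c = {x \<in> A. \<kappa> x = c}" for c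
  have B[measurable]: "B c \<in> sets borel" for c
    unfolding B_def by (rule real_interval_borel_measurable[OF I])
  have ind: "indicator A x = (\<Sum>c\<in>range \<kappa>. indicator (B c) x :: real)" for x
  proof -
    have "(\<Sum>c\<in>range \<kappa>. indicator (B c) x :: real) = (\<Sum>c\<in>{\<kappa> x}. indicator (B c) x)"
      using fin by (intro sum.mono_neutral_right) (auto simp: B_def indicator_def)
    then show ?thesis by (simp add: B_def indicator_def)
  qed
  have A: "A = (\<Union>c\<in>range \<kappa>. B c)" by (auto simp: B_def)
  have p: "prob A = (\<Sum>c\<in>range \<kappa>. prob (B c))"
    unfolding A using fin by (intro finite_measure_finite_Union) (use B in \<open>auto simp: disjoint_family_on_def\<close>, auto simp: B_def)
  have "(\<Sum>i=1..n. indicator A (X i)) - n * prob A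
      = (\<Sum>c\<in>range \<kappa>. (\<Sum>i=1..n. indicator (B c) (X i)) - n * prob (B c))"
    unfolding ind p sum_subtractf sum_distrib_left by (subst sum.swap) simp
  also have "\<bar>\<dots>\<bar> \<le> (\<Sum>c\<in>range \<kappa>. l * (n * prob (B c)) + L / l + 4)"
    unfolding l_def
    by (intro order_trans[OF sum_abs] sum_mono regular_sample_interval[OF atomless reg e L m])
       (simp add: B_def I)
  also have "\<dots> = l * (n * prob A) + card (range \<kappa>) * (L / l + 4)"
    unfolding p by (simp add: sum.distrib sum_distrib_left algebra_simps)
  finally show ?thesis .
qed

text \<open>Layer \<open>k\<close> is charged slope \<open>e * k / n\<close>. The proportional parts
  then sum to \<open>e * n\<close> times the second moment by the third layer bound, and the
  additive parts \<open>L / (e * k / n)\<close> to a harmonic number. The factor 2 accounts for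
  positive and negative layers; the final 2 is the rounding error of the layers, 1 for the sample
  and 1 for the mean.\<close>

lemma regular_sample_piecewise_antimono:
  fixes n :: nat and \<kappa> :: "real \<Rightarrow> 'b"
  assumes atomless: "\<And>x. prob {x} = 0" and reg: "regular_sample n e L X"
    and e: "0 < e" "e \<le> 1" and L: "0 \<le> L" and n: "0 < n"
    and fin: "finite (range \<kappa>)" and I: "\<And>c. is_interval {x. \<kappa> x = c}"
    and [measurable]: "f \<in> borel_measurable borel" and f1: "\<And>x. \<bar>f x\<bar> \<le> 1"
    and anti: "\<And>x y. x \<le> y \<Longrightarrow> \<kappa> x = \<kappa> y \<Longrightarrow> f y \<le> f x"
  shows "(\<Sum>i=1..n. f (X i)) - n * (\<integral>x. f x \<partial>M)
    \<le> e * (n * (\<integral>x. (f x)\<^sup>2 \<partial>M)) + 2 * card (range \<kappa>) * (L / e * (1 + ln n) + 4) + 2"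
proof -
  let ?N = "\<lambda>A. (\<Sum>i=1..n. indicator A (X i)) :: real"
  let ?K = "real (card (range \<kappa>))"
  define U V where "U k = {x. real k / n < f x}" and "V k = {x. f x < - (real k / n)}" for k :: nat
  have [measurable]: "U k \<in> sets borel" "V k \<in> sets borel" for k
    unfolding U_def V_def by measurable
  have int_ind: "integrable M (\<lambda>x. indicator A x :: real)" "(\<integral>x. indicator A x \<partial>M) = prob A"
    if "A \<in> sets borel" for A using that by (auto intro!: integrable_real_indicator simp: emeasure_eq_measure)
  have int_f: "integrable M f"
    using f1 by (intro integrable_const_bound[of _ 1]) auto
  have int_f2: "integrable M (\<lambda>x. (f x)\<^sup>2)"
    using f1 by (intro integrable_const_bound[of _ 1]) (auto simp: abs_square_le_1)
  have layers: "f x \<le> (\<Sum>k=1..n. indicator (U k) x - indicator (V k) x) / n + 1 / n"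
    "(\<Sum>k=1..n. indicator (U k) x - indicator (V k) x) / n - 1 / n \<le> f x"
    "(\<Sum>k=1..n. k / n * (indicator (U k) x + indicator (V k) x)) \<le> n * (f x)\<^sup>2" for x
    using layer_bounds[OF f1 n, of x] by (simp_all add: U_def V_def indicator_def)
  have 1: "(\<Sum>i=1..n. f (X i)) \<le> (\<Sum>k=1..n. ?N (U k) - ?N (V k)) / n + 1"
  proof -
    have "(\<Sum>i=1..n. f (X i)) \<le> (\<Sum>i=1..n. (\<Sum>k=1..n. indicator (U k) (X i) - indicator (V k) (X i)) / n + 1 / n)"
      by (intro sum_mono layers)
    also have "\<dots> = (\<Sum>i=1..n. \<Sum>k=1..n. indicator (U k) (X i) - indicator (V k) (X i)) / n + 1"
      using n by (simp add: sum.distrib sum_divide_distrib)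
    also have "(\<Sum>i=1..n. \<Sum>k=1..n. indicator (U k) (X i) - indicator (V k) (X i)) = (\<Sum>k=1..n. ?N (U k) - ?N (V k))"
      by (subst sum.swap) (simp add: sum_subtractf)
    finally show ?thesis .
  qed
  have 2: "(\<Sum>k=1..n. n * prob (U k) - n * prob (V k)) / n - 1 \<le> n * (\<integral>x. f x \<partial>M)"
  proof -
    have "(\<integral>x. (\<Sum>k=1..n. indicator (U k) x - indicator (V k) x) / n - 1 / n \<partial>M) \<le> (\<integral>x. f x \<partial>M)"
      by (intro integral_mono layers int_f Bochner_Integration.integrable_diff integrable_const
          Bochner_Integration.integrable_divide Bochner_Integration.integrable_sum int_ind) auto
    also have "(\<integral>x. (\<Sum>k=1..n. indicator (U k) x - indicator (V k) x) / n - 1 / n \<partial>M)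
        = (\<Sum>k=1..n. prob (U k) - prob (V k)) / n - 1 / n"
      by (simp add: int_ind Bochner_Integration.integral_diff Bochner_Integration.integral_sum prob_space[simplified])
    finally have "(\<Sum>k=1..n. prob (U k) - prob (V k)) - 1 \<le> n * (\<integral>x. f x \<partial>M)"
      using n by (simp add: field_simps)
    moreover have "(\<Sum>k=1..n. n * prob (U k) - n * prob (V k)) = n * (\<Sum>k=1..n. prob (U k) - prob (V k))"
      by (simp add: sum_distrib_left right_diff_distrib)
    ultimately show ?thesis using n by simp
  qed
  have 3: "(\<Sum>k=1..n. k / n * (prob (U k) + prob (V k))) \<le> n * (\<integral>x. (f x)\<^sup>2 \<partial>M)"
  proof -
    have "(\<integral>x. (\<Sum>k=1..n. k / n * (indicator (U k) x + indicator (V k) x)) \<partial>M) \<le> (\<integral>x. n * (f x)\<^sup>2 \<partial>M)"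
      by (intro integral_mono layers int_f2 Bochner_Integration.integrable_mult_right
          Bochner_Integration.integrable_add Bochner_Integration.integrable_sum int_ind) auto
    then show ?thesis
      by (simp add: int_ind)
  qed
  \<comment> \<open>Within a piece \<open>f\<close> is antitone, so \<open>U k\<close> cuts out an
    initial segment and \<open>V k\<close> a final one.\<close>
  have intvU: "is_interval {x \<in> U k. \<kappa> x = c}" and intvV: "is_interval {x \<in> V k. \<kappa> x = c}" for k c
  proof -
    have mem: "\<kappa> x = c" if "\<kappa> a = c" "\<kappa> b = c" "a \<le> x" "x \<le> b" for a b x
      using mem_is_interval_1_I[OF I[of c], of a b x] that by simp
    show "is_interval {x \<in> U k. \<kappa> x = c}"
      unfolding is_interval_1 U_def using mem anti by (smt (verit, del_insts) mem_Collect_eq)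
    show "is_interval {x \<in> V k. \<kappa> x = c}"
      unfolding is_interval_1 V_def using mem anti by (smt (verit, del_insts) mem_Collect_eq)
  qed
  have layer: "(?N (U k) - n * prob (U k)) - (?N (V k) - n * prob (V k))
      \<le> e * n * (k / n * (prob (U k) + prob (V k))) + 2 * ?K * (L / e * n * inverse k + 4)"
    if k: "k \<in> {1..n}" for k
  proof -
    note b = regular_sample_pieces[OF atomless reg e L k fin]
    have "(?N (U k) - n * prob (U k)) - (?N (V k) - n * prob (V k))
      \<le> (e * real k / n * (n * prob (U k)) + ?K * (L / (e * real k / n) + 4))
        + (e * real k / n * (n * prob (V k)) + ?K * (L / (e * real k / n) + 4))"
      using b[of "U k", OF intvU] b[of "V k", OF intvV] unfolding abs_le_iff by linarith
    also have "\<dots> = e * n * (k / n * (prob (U k) + prob (V k))) + 2 * ?K * (L / e * n * inverse k + 4)"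
      by (simp add: field_simps)
    finally show ?thesis .
  qed
  have "(\<Sum>i=1..n. f (X i)) - n * (\<integral>x. f x \<partial>M)
      \<le> (\<Sum>k=1..n. (?N (U k) - n * prob (U k)) - (?N (V k) - n * prob (V k))) / n + 2"
    using 1 2 by (simp add: sum_subtractf diff_divide_distrib)
  also have "\<dots> \<le> (\<Sum>k=1..n. e * n * (k / n * (prob (U k) + prob (V k))) + 2 * ?K * (L / e * n * inverse k + 4)) / n + 2"
    by (intro add_right_mono divide_right_mono sum_mono layer) auto
  also have "(\<Sum>k=1..n. e * n * (k / n * (prob (U k) + prob (V k))) + 2 * ?K * (L / e * n * inverse k + 4))
      = e * n * (\<Sum>k=1..n. k / n * (prob (U k) + prob (V k))) + 2 * ?K * (L / e * n * harm n + 4 * n)"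
    by (simp add: sum.distrib sum_distrib_left harm_def algebra_simps)
  also have "\<dots> / n = e * (\<Sum>k=1..n. k / n * (prob (U k) + prob (V k))) + 2 * ?K * (L / e * harm n + 4)"
    using n by (simp add: field_simps)
  also have "\<dots> \<le> e * (n * (\<integral>x. (f x)\<^sup>2 \<partial>M)) + 2 * ?K * (L / e * (1 + ln n) + 4)"
    using 3 e L harm_le_ln[OF n] by (intro add_mono mult_left_mono) auto
  finally show ?thesis by simp
qed

end

section \<open>Hellinger distance and the test statistic\<close>

lemma densitiesD:
  assumes "t \<in> densities"
  shows "t \<in> borel_measurable borel" "0 \<le> t x" "integrable lborel t" "(\<integral>x. t x \<partial>lborel) = 1"
proof -
  have t: "t \<in> borel_measurable borel" "\<And>x. 0 \<le> t x" "(\<integral>\<^sup>+x. ennreal (t x) \<partial>lborel) = 1"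
    using assms by (auto simp: densities_def)
  then show "t \<in> borel_measurable borel" "0 \<le> t x" by auto
  show "integrable lborel t" using t by (intro integrableI_nonneg) auto
  show "(\<integral>x. t x \<partial>lborel) = 1"
    using t by (subst integral_eq_nn_integral) auto
qed

lemma densitiesI:
  assumes "integrable lborel t" "\<And>x. 0 \<le> t x" "(\<integral>x. t x \<partial>lborel) = 1"
  shows "t \<in> densities"
  using assms nn_integral_eq_integral[of lborel t] by (auto simp: densities_def)

lemma density_mean:
  assumes "t \<in> densities" "u \<in> densities"
  shows "(\<lambda>x. (t x + u x) / 2) \<in> densities"
  using densitiesD[OF assms(1)] densitiesD[OF assms(2)] by (intro densitiesI) auto

lemma real_distribution_density:
  assumes "s \<in> densities"
  shows "real_distribution (density lborel (\<lambda>x. ennreal (s x)))"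
    and "measure (density lborel (\<lambda>x. ennreal (s x))) {x} = 0"
proof -
  note s = densitiesD[OF assms]
  have [measurable]: "s \<in> borel_measurable borel" by (fact s)
  have 1: "(\<integral>\<^sup>+x. ennreal (s x) \<partial>lborel) = 1" using assms by (auto simp: densities_def)
  have "prob_space (density lborel (\<lambda>x. ennreal (s x)))"
    by (rule prob_spaceI) (simp add: emeasure_density 1)
  then show "real_distribution (density lborel (\<lambda>x. ennreal (s x)))"
    by (simp add: real_distribution_def real_distribution_axioms_def)
  have "emeasure (density lborel (\<lambda>x. ennreal (s x))) {x} = 0"
    by (simp add: emeasure_density nn_integral_0_iff_AE AE_lborel_singleton)
  then show "measure (density lborel (\<lambda>x. ennreal (s x))) {x} = 0"
    by (simp add: measure_def)
qed

lemma hellinger_sq: "(hellinger t u)\<^sup>2 = 1 / 2 * (\<integral>x. (sqrt (t x) - sqrt (u x))\<^sup>2 \<partial>lborel)"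
  unfolding hellinger_def by (intro real_sqrt_pow2 mult_nonneg_nonneg integral_nonneg) auto

lemma hellinger_commute: "hellinger t u = hellinger u t"
  unfolding hellinger_def by (simp add: power2_commute)

lemma integrable_sqrt_mult:
  assumes "t \<in> densities" "u \<in> densities"
  shows "integrable lborel (\<lambda>x. sqrt (t x) * sqrt (u x))"
proof (rule Bochner_Integration.integrable_bound[of _ "\<lambda>x. t x + u x"])
  note t = densitiesD[OF assms(1)] and u = densitiesD[OF assms(2)]
  show "integrable lborel (\<lambda>x. t x + u x)" using t u by auto
  show "(\<lambda>x. sqrt (t x) * sqrt (u x)) \<in> borel_measurable lborel" using t u by auto
  have "sqrt (t x) * sqrt (u x) \<le> t x + u x" for x
    using arith_geo_mean_sqrt[of "t x" "u x"] t(2)[of x] u(2)[of x] by (simp add: real_sqrt_mult)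
  then show "AE x in lborel. norm (sqrt (t x) * sqrt (u x)) \<le> norm (t x + u x)"
    using t(2) u(2) by (auto simp: abs_mult)
qed

lemma sqrt_diff_sq:
  "0 \<le> a \<Longrightarrow> 0 \<le> b \<Longrightarrow> (sqrt a - sqrt b)\<^sup>2 = a + b - 2 * (sqrt a * sqrt b)"
  by (simp add: power2_diff)

lemma integrable_hellinger:
  assumes "t \<in> densities" "u \<in> densities"
  shows "integrable lborel (\<lambda>x. (sqrt (t x) - sqrt (u x))\<^sup>2)"
  using integrable_sqrt_mult[OF assms] densitiesD[OF assms(1)] densitiesD[OF assms(2)]
  by (simp add: sqrt_diff_sq)

lemma hellinger_sq_le_1:
  assumes "t \<in> densities" "u \<in> densities"
  shows "(hellinger t u)\<^sup>2 \<le> 1"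
proof -
  note t = densitiesD[OF assms(1)] and u = densitiesD[OF assms(2)]
  have "(\<integral>x. (sqrt (t x) - sqrt (u x))\<^sup>2 \<partial>lborel) \<le> (\<integral>x. t x + u x \<partial>lborel)"
    using integrable_hellinger[OF assms] t u
    by (intro integral_mono) (auto simp: sqrt_diff_sq)
  then show ?thesis using t u by (simp add: hellinger_sq)
qed

text \<open>Pointwise, the two sides differ by the square of \<open>a - 2 * b + c\<close> in terms
  of square roots. The squared form is the one that risk bounds consume.\<close>

lemma hellinger_sq_triangle:
  assumes "t \<in> densities" "u \<in> densities" "v \<in> densities"
  shows "(hellinger t v)\<^sup>2 \<le> 2 * (hellinger t u)\<^sup>2 + 2 * (hellinger u v)\<^sup>2"
proof -
  have "(a - c)\<^sup>2 \<le> 2 * (a - b)\<^sup>2 + 2 * (b - c)\<^sup>2" for a b c :: real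
    using zero_le_power2[of "a - 2 * b + c"] by (simp add: power2_eq_square algebra_simps)
  then have "(\<integral>x. (sqrt (t x) - sqrt (v x))\<^sup>2 \<partial>lborel) \<le>
    (\<integral>x. 2 * (sqrt (t x) - sqrt (u x))\<^sup>2 + 2 * (sqrt (u x) - sqrt (v x))\<^sup>2 \<partial>lborel)"
    using integrable_hellinger assms by (intro integral_mono) auto
  then show ?thesis
    using integrable_hellinger assms by (simp add: hellinger_sq)
qed

section \<open>The score: the function \<open>rho_psi\<close> in terms of two density values\<close>

definition score :: "real \<Rightarrow> real \<Rightarrow> real" where
  "score a b = (sqrt b - sqrt a) / sqrt (a + b)"

text \<open>The conventions agree: division by zero gives \<open>score 0 0 = 0\<close>, the value of
  \<open>rho_psi\<close> at 1, and \<open>score 0 b = 1\<close> for \<open>b > 0\<close>, its value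
  at infinity.\<close>

lemma rho_psi_sqrt_ratio:
  assumes "0 \<le> a" "0 \<le> b"
  shows "rho_psi (sqrt_ratio b a) = score a b"
proof (cases "a = 0")
  case True
  then show ?thesis using assms
    by (auto simp: rho_psi_def sqrt_ratio_def score_def one_ereal_def)
next
  case False
  then have a: "0 < a" using assms by simp
  have "1 + b / a = (a + b) / a" using a by (simp add: field_simps)
  then show ?thesis using a assms
    by (simp add: rho_psi_def sqrt_ratio_def score_def real_sqrt_divide field_simps)
qed

lemma score_antisym: "score b a = - score a b"
  by (simp add: score_def add.commute minus_divide_left)

lemma score_abs_le_1:
  assumes "0 \<le> a" "0 \<le> b"
  shows "\<bar>score a b\<bar> \<le> 1"
proof -
  have "(sqrt b - sqrt a)\<^sup>2 \<le> a + b" using assms by (simp add: sqrt_diff_sq)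
  then have "\<bar>sqrt b - sqrt a\<bar> \<le> sqrt (a + b)" by (intro real_le_rsqrt) simp
  moreover have "0 < a + b \<or> a + b = 0" using assms by linarith
  ultimately show ?thesis by (auto simp: score_def abs_divide divide_le_eq_1)
qed

lemma score_mono:
  assumes a: "0 \<le> a" and b: "0 \<le> b" and bc: "b \<le> c"
  shows "score a b \<le> score a c"
proof (cases "a = 0")
  case True
  then show ?thesis using b bc by (auto simp: score_def)
next
  case False
  define x y z where "x = sqrt a" and "y = sqrt b" and "z = sqrt c"
  have xyz: "0 < x" "0 \<le> y" "y \<le> z" "a = x\<^sup>2" "b = y\<^sup>2" "c = z\<^sup>2"
    using False assms by (auto simp: x_def y_def z_def)
  have pos: "0 < sqrt (x\<^sup>2 + y\<^sup>2)" "0 < sqrt (x\<^sup>2 + z\<^sup>2)" using xyz by (auto intro: add_pos_nonneg)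
  have le: "sqrt (x\<^sup>2 + y\<^sup>2) \<le> sqrt (x\<^sup>2 + z\<^sup>2)" using xyz by (auto intro: power_mono)
  have "(y - x) * sqrt (x\<^sup>2 + z\<^sup>2) \<le> (z - x) * sqrt (x\<^sup>2 + y\<^sup>2)"
  proof -
    consider "y \<le> x" "x \<le> z" | "z \<le> x" | "x \<le> y" using xyz by linarith
    then show ?thesis
    proof cases
      case 1
      then have "(y - x) * sqrt (x\<^sup>2 + z\<^sup>2) \<le> 0" "0 \<le> (z - x) * sqrt (x\<^sup>2 + y\<^sup>2)"
        using pos by (auto intro: mult_nonpos_nonneg)
      then show ?thesis by linarith
    next
      case 2
      then have "(x - z) * sqrt (x\<^sup>2 + y\<^sup>2) \<le> (x - y) * sqrt (x\<^sup>2 + z\<^sup>2)"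
        using xyz le pos by (intro mult_mono) auto
      then show ?thesis by (simp add: algebra_simps)
    next
      case 3
      have "x\<^sup>2 \<le> y * z" using 3 xyz by (auto simp: power2_eq_square intro: mult_mono)
      \<comment> \<open>This product is exactly
        \<open>(z - x)^2 * (x^2 + y^2) - (y - x)^2 * (x^2 + z^2)\<close>.\<close>
      then have "0 \<le> 2 * x * (z - y) * (y * z - x\<^sup>2)" using xyz by simp
      then have "(y - x)\<^sup>2 * (x\<^sup>2 + z\<^sup>2) \<le> (z - x)\<^sup>2 * (x\<^sup>2 + y\<^sup>2)"
        by (simp add: power2_eq_square algebra_simps)
      then have "((y - x) * sqrt (x\<^sup>2 + z\<^sup>2))\<^sup>2 \<le> ((z - x) * sqrt (x\<^sup>2 + y\<^sup>2))\<^sup>2"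
        by (simp add: power_mult_distrib)
      then show ?thesis
        by (rule power2_le_imp_le) (use 3 xyz in auto)
    qed
  qed
  then show ?thesis
    using pos xyz by (simp add: score_def divide_le_eq pos_le_divide_eq)
qed

text \<open>Moving \<open>sqrt a\<close> to \<open>sqrt c\<close> changes the numerator and the norm
  in the denominator by at most their distance each, and the quotient is at most 1 in absolute
  value; hence the factor 2. The error does not involve \<open>b\<close>, which gives uniformity
  over \<open>t'\<close>.\<close>

lemma score_perturb:
  assumes "0 \<le> a" "0 \<le> b" "0 < c"
  shows "score c b \<le> score a b + 2 * \<bar>sqrt c - sqrt a\<bar> / sqrt c"
proof -
  define x y z where "x = sqrt a" and "y = sqrt b" and "z = sqrt c"
  have xyz: "0 \<le> x" "0 \<le> y" "0 < z" "a = x\<^sup>2" "b = y\<^sup>2" "c = z\<^sup>2"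
    using assms by (auto simp: x_def y_def z_def)
  define p q where "p = sqrt (z\<^sup>2 + y\<^sup>2)" and "q = sqrt (x\<^sup>2 + y\<^sup>2)"
  have p: "z \<le> p" using xyz by (auto simp: p_def intro: real_le_rsqrt)
  have qp: "q \<le> p + \<bar>z - x\<bar>"
    using real_sqrt_sum_squares_triangle_ineq[of z "x - z" y 0] by (simp add: p_def q_def abs_minus_commute)
  have pq: "p \<le> q + \<bar>z - x\<bar>"
    using real_sqrt_sum_squares_triangle_ineq[of x "z - x" y 0] by (simp add: p_def q_def)
  have "\<bar>(y - x) / q\<bar> \<le> 1"
    using score_abs_le_1[of "x\<^sup>2" "y\<^sup>2"] xyz by (simp add: score_def q_def)
  moreover have "(y - x) = (y - x) / q * q"
    using xyz by (auto simp: q_def)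
  ultimately obtain w where w: "\<bar>w\<bar> \<le> 1" "y - x = w * q" "(y - x) / q = w" by blast
  have "w * q \<le> w * p + \<bar>z - x\<bar>"
  proof -
    have "w * (q - p) \<le> \<bar>w\<bar> * \<bar>q - p\<bar>" by (simp add: abs_mult[symmetric])
    also have "\<dots> \<le> 1 * \<bar>z - x\<bar>" using w qp pq by (intro mult_mono) auto
    finally show ?thesis by (simp add: algebra_simps)
  qed
  then have "y - x + (x - z) \<le> w * p + \<bar>z - x\<bar> + \<bar>z - x\<bar>"
    unfolding w(2) by (intro add_mono) auto
  then have "y - z \<le> w * p + 2 * \<bar>z - x\<bar>" by simp
  then have "(y - z) / p \<le> (w * p + 2 * \<bar>z - x\<bar>) / p"
    using p xyz by (intro divide_right_mono) auto
  also have "\<dots> = w + 2 * \<bar>z - x\<bar> / p" using p xyz by (simp add: field_simps)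
  also have "\<dots> \<le> w + 2 * \<bar>z - x\<bar> / z" using p xyz by (intro add_left_mono divide_left_mono) auto
  finally have "(y - z) / p \<le> w + 2 * \<bar>z - x\<bar> / z" .
  moreover have "score c b = (y - z) / p" using assms by (simp add: score_def p_def y_def z_def)
  moreover have "score a b = w" using assms w(3) by (simp add: score_def q_def x_def y_def)
  ultimately show ?thesis by (simp only: x_def z_def)
qed

lemma borel_measurable_score [measurable (raw)]:
  assumes [measurable]: "f \<in> borel_measurable M" "g \<in> borel_measurable M"
  shows "(\<lambda>x. score (f x) (g x)) \<in> borel_measurable M"
  unfolding score_def by measurable

section \<open>The deterministic part of the test statistic, and bounds on the statistic
  itself\<close>

definition rho_drift :: "(real \<Rightarrow> real) \<Rightarrow> (real \<Rightarrow> real) \<Rightarrow> real" where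
  "rho_drift t t' = (hellinger t (\<lambda>x. (t x + t' x) / 2))\<^sup>2 - (hellinger t' (\<lambda>x. (t x + t' x) / 2))\<^sup>2"

lemma rho_drift_antisym: "rho_drift t' t = - rho_drift t t'"
  by (simp add: rho_drift_def add.commute)

lemma rho_drift_abs_le_1:
  assumes "t \<in> densities" "t' \<in> densities"
  shows "\<bar>rho_drift t t'\<bar> \<le> 1"
  using hellinger_sq_le_1[OF assms(1) density_mean[OF assms]] hellinger_sq_le_1[OF assms(2) density_mean[OF assms]]
  by (auto simp: rho_drift_def abs_le_iff) (smt (verit) zero_le_power2)+

text \<open>On expanding the squares the midpoint density cancels pointwise, and
  \<open>t - t'\<close> integrates to 0.\<close>

lemma rho_drift_integral:
  assumes "t \<in> densities" "t' \<in> densities"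
  shows "integrable lborel (\<lambda>x. (sqrt (t' x) - sqrt (t x)) * sqrt ((t x + t' x) / 2))"
    and "rho_drift t t' = (\<integral>x. (sqrt (t' x) - sqrt (t x)) * sqrt ((t x + t' x) / 2) \<partial>lborel)"
proof -
  note t = densitiesD[OF assms(1)] and t' = densitiesD[OF assms(2)] and r = density_mean[OF assms]
  have i: "integrable lborel (\<lambda>x. sqrt (t x) * sqrt ((t x + t' x) / 2))"
    "integrable lborel (\<lambda>x. sqrt (t' x) * sqrt ((t x + t' x) / 2))"
    using integrable_sqrt_mult[OF assms(1) r] integrable_sqrt_mult[OF assms(2) r] by auto
  then show "integrable lborel (\<lambda>x. (sqrt (t' x) - sqrt (t x)) * sqrt ((t x + t' x) / 2))"
    unfolding left_diff_distrib by auto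
  have "2 * rho_drift t t' = (\<integral>x. (sqrt (t x) - sqrt ((t x + t' x) / 2))\<^sup>2
      - (sqrt (t' x) - sqrt ((t x + t' x) / 2))\<^sup>2 \<partial>lborel)"
    unfolding rho_drift_def hellinger_sq
    using integrable_hellinger[OF assms(1) r] integrable_hellinger[OF assms(2) r]
    by (subst Bochner_Integration.integral_diff) auto
  also have "\<dots> = (\<integral>x. t x - t' x + 2 * ((sqrt (t' x) - sqrt (t x)) * sqrt ((t x + t' x) / 2)) \<partial>lborel)"
    using t(2) t'(2) by (intro Bochner_Integration.integral_cong) (auto simp: sqrt_diff_sq algebra_simps)
  also have "\<dots> = 2 * (\<integral>x. (sqrt (t' x) - sqrt (t x)) * sqrt ((t x + t' x) / 2) \<partial>lborel)"
    using t t' i unfolding left_diff_distrib by simp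
  finally show "rho_drift t t' = (\<integral>x. (sqrt (t' x) - sqrt (t x)) * sqrt ((t x + t' x) / 2) \<partial>lborel)"
    by simp
qed

lemma rho_T_eq:
  assumes "t \<in> densities" "t' \<in> densities"
  shows "rho_T n X t t' = n / 2 * rho_drift t t' + 1 / sqrt 2 * (\<Sum>i=1..n. score (t (X i)) (t' (X i)))"
  using densitiesD(2)[OF assms(1)] densitiesD(2)[OF assms(2)]
  by (simp add: rho_T_def rho_drift_def rho_psi_sqrt_ratio)

lemma rho_T_antisym:
  assumes "t \<in> densities" "t' \<in> densities"
  shows "rho_T n X t' t = - rho_T n X t t'"
  using assms rho_drift_antisym[of t t'] score_antisym[of "t' (X _)" "t (X _)"]
  by (simp add: rho_T_eq sum_negf)

lemma rho_T_abs_le: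
  assumes "t \<in> densities" "t' \<in> densities"
  shows "\<bar>rho_T n X t t'\<bar> \<le> 2 * real n"
proof -
  have "\<bar>\<Sum>i=1..n. score (t (X i)) (t' (X i))\<bar> \<le> (\<Sum>i=1..n. 1)"
    using densitiesD(2)[OF assms(1)] densitiesD(2)[OF assms(2)]
    by (intro order_trans[OF sum_abs] sum_mono score_abs_le_1)
  then have "\<bar>1 / sqrt 2 * (\<Sum>i=1..n. score (t (X i)) (t' (X i)))\<bar> \<le> 1 * real n"
    unfolding abs_mult by (intro mult_mono) auto
  moreover have "\<bar>n / 2 * rho_drift t t'\<bar> \<le> n / 2 * 1"
    unfolding abs_mult using rho_drift_abs_le_1[OF assms] by (intro mult_mono) auto
  ultimately show ?thesis unfolding rho_T_eq[OF assms] by linarith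
qed

text \<open>The quadratic mean of \<open>a\<close> and \<open>b\<close> is at least their arithmetic
  mean; this is used in the cross term.\<close>

lemma mean_sqrt_diff_sq_le:
  fixes a b c :: real
  assumes "0 \<le> a" "0 \<le> b" "0 \<le> c"
  shows "(sqrt ((a\<^sup>2 + b\<^sup>2) / 2) - c)\<^sup>2 \<le> ((c - a)\<^sup>2 + (c - b)\<^sup>2) / 2"
proof -
  have "(a + b) / 2 \<le> sqrt ((a\<^sup>2 + b\<^sup>2) / 2)"
    using zero_le_power2[of "a - b"]
    by (intro real_le_rsqrt) (simp add: power2_eq_square field_simps)
  then have "(a + b) / 2 * c \<le> sqrt ((a\<^sup>2 + b\<^sup>2) / 2) * c" using assms by (intro mult_right_mono)
  moreover have "(sqrt ((a\<^sup>2 + b\<^sup>2) / 2))\<^sup>2 = (a\<^sup>2 + b\<^sup>2) / 2" by simp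
  ultimately show ?thesis by (simp add: power2_diff field_simps)
qed

lemma score_mult_sqrt:
  assumes "0 \<le> a" "0 \<le> b"
  shows "score (a\<^sup>2) (b\<^sup>2) * (sqrt 2 * sqrt ((a\<^sup>2 + b\<^sup>2) / 2)) = b - a"
proof (cases "a\<^sup>2 + b\<^sup>2 = 0")
  case True
  then show ?thesis by (simp add: sum_power2_eq_zero_iff)
next
  case False
  then show ?thesis using assms by (simp add: score_def real_sqrt_divide)
qed

text \<open>Here \<open>a\<close>, \<open>b\<close>, \<open>c\<close> stand for the square roots of
  \<open>t\<close>, \<open>t'\<close>, \<open>s\<close>. With \<open>w\<close> the score and
  \<open>r\<close> the quadratic mean, \<open>b - a = w * sqrt 2 * r\<close> turns the left side
  into \<open>(b - a) * c + sqrt 2 / 2 * w * (r - c)^2\<close>. The first term is half of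
  \<open>(c - a)^2 - (c - b)^2 + b^2 - a^2\<close>; the second, by
  \<open>\<bar>w\<bar> \<le> 1\<close>, cannot cancel the negative coefficient. The term
  \<open>b^2 - a^2\<close> integrates to 0.\<close>

lemma drift_pointwise:
  fixes a b c :: real
  assumes "0 \<le> a" "0 \<le> b" "0 \<le> c"
  shows "1 / 2 * ((b - a) * sqrt ((a\<^sup>2 + b\<^sup>2) / 2)) + 1 / sqrt 2 * (score (a\<^sup>2) (b\<^sup>2) * c\<^sup>2)
    \<le> (1 / 2 + sqrt 2 / 4) * (c - a)\<^sup>2 - (1 / 2 - sqrt 2 / 4) * (c - b)\<^sup>2 + (b\<^sup>2 - a\<^sup>2) / 2"
proof -
  define r where "r = sqrt ((a\<^sup>2 + b\<^sup>2) / 2)"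
  define w where "w = score (a\<^sup>2) (b\<^sup>2)"
  have r0: "0 \<le> r" and r2: "2 * r\<^sup>2 = a\<^sup>2 + b\<^sup>2" by (auto simp: r_def)
  have w1: "\<bar>w\<bar> \<le> 1" unfolding w_def by (rule score_abs_le_1) auto
  have ba: "b - a = w * (sqrt 2 * r)"
    using score_mult_sqrt[OF assms(1,2)] by (simp add: w_def r_def)
  have "1 / 2 * ((b - a) * r) + 1 / sqrt 2 * (w * c\<^sup>2) = sqrt 2 / 2 * (w * (r\<^sup>2 + c\<^sup>2))"
    unfolding ba by (simp add: field_simps power2_eq_square)
  also have "\<dots> = (b - a) * c + sqrt 2 / 2 * (w * (r - c)\<^sup>2)"
    unfolding ba by (simp add: field_simps power2_eq_square)
  also have "w * (r - c)\<^sup>2 \<le> 1 * ((c - a)\<^sup>2 + (c - b)\<^sup>2) / 2"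
    using mean_sqrt_diff_sq_le[OF assms] w1 mult_mono[of w 1 "(r - c)\<^sup>2" "((c - a)\<^sup>2 + (c - b)\<^sup>2) / 2"]
    by (simp add: r_def)
  also have "(b - a) * c + sqrt 2 / 2 * (1 * ((c - a)\<^sup>2 + (c - b)\<^sup>2) / 2)
     = (1 / 2 + sqrt 2 / 4) * (c - a)\<^sup>2 - (1 / 2 - sqrt 2 / 4) * (c - b)\<^sup>2 + (b\<^sup>2 - a\<^sup>2) / 2"
    by (simp add: power2_eq_square algebra_simps) (simp add: field_simps)
  finally show ?thesis by (simp add: r_def w_def mult_left_mono)
qed

text \<open>Splits \<open>c\<close> around the quadratic mean \<open>r\<close>: the part near
  \<open>r\<close> contributes \<open>w^2 * 2 * r^2 = (b - a)^2\<close>, the remainder is controlled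
  by \<open>w^2 \<le> 1\<close>. The constant is 1 + 2.\<close>

lemma variance_pointwise:
  fixes a b c :: real
  assumes "0 \<le> a" "0 \<le> b" "0 \<le> c"
  shows "(score (a\<^sup>2) (b\<^sup>2))\<^sup>2 * c\<^sup>2 \<le> 3 * ((c - a)\<^sup>2 + (c - b)\<^sup>2)"
proof -
  define r where "r = sqrt ((a\<^sup>2 + b\<^sup>2) / 2)"
  define w where "w = score (a\<^sup>2) (b\<^sup>2)"
  have w1: "\<bar>w\<bar> \<le> 1" unfolding w_def by (rule score_abs_le_1) auto
  have w2: "w\<^sup>2 \<le> 1" using w1 by (simp add: abs_square_le_1)
  have wr: "w\<^sup>2 * (2 * r\<^sup>2) = (b - a)\<^sup>2"
    using score_mult_sqrt[OF assms(1,2), symmetric] unfolding w_def[symmetric] r_def[symmetric]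
    by (simp add: power_mult_distrib)
  have "c\<^sup>2 \<le> 2 * (r - c)\<^sup>2 + 2 * r\<^sup>2"
    using zero_le_power2[of "2 * r - c"] by (simp add: power2_eq_square algebra_simps)
  then have "w\<^sup>2 * c\<^sup>2 \<le> w\<^sup>2 * (2 * (r - c)\<^sup>2 + 2 * r\<^sup>2)" by (intro mult_left_mono) auto
  also have "\<dots> = w\<^sup>2 * (2 * (r - c)\<^sup>2) + (b - a)\<^sup>2" using wr by (simp add: algebra_simps)
  also have "w\<^sup>2 * (2 * (r - c)\<^sup>2) \<le> 1 * ((c - a)\<^sup>2 + (c - b)\<^sup>2)"
    using w2 mean_sqrt_diff_sq_le[OF assms] by (intro mult_mono) (auto simp: r_def)
  also have "(b - a)\<^sup>2 \<le> 2 * ((c - a)\<^sup>2 + (c - b)\<^sup>2)"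
    using zero_le_power2[of "a + b - 2 * c"] by (simp add: power2_eq_square algebra_simps)
  finally show ?thesis by (simp add: w_def)
qed

lemma integrable_bounded_mult_density:
  fixes f :: "real \<Rightarrow> real"
  assumes s: "s \<in> densities" and [measurable]: "f \<in> borel_measurable borel" and f: "\<And>x. \<bar>f x\<bar> \<le> 1"
  shows "integrable lborel (\<lambda>x. f x * s x)"
    and "(\<integral>x. f x \<partial>density lborel (\<lambda>x. ennreal (s x))) = (\<integral>x. f x * s x \<partial>lborel)"
proof -
  note s = densitiesD[OF s]
  have [measurable]: "s \<in> borel_measurable borel" by (fact s)
  have "\<bar>f x * s x\<bar> \<le> \<bar>s x\<bar>" for x
    using mult_right_mono[OF f[of x], of "\<bar>s x\<bar>"] by (simp add: abs_mult)
  then show "integrable lborel (\<lambda>x. f x * s x)"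
    by (intro Bochner_Integration.integrable_bound[OF s(3)]) auto
  show "(\<integral>x. f x \<partial>density lborel (\<lambda>x. ennreal (s x))) = (\<integral>x. f x * s x \<partial>lborel)"
    using s by (subst integral_density) (auto simp: mult.commute)
qed

text \<open>Integrated forms of \<open>drift_pointwise\<close> and
  \<open>variance_pointwise\<close>; each squared difference integrates to twice a squared Hellinger
  distance.\<close>

lemma
  assumes s: "s \<in> densities" and t: "t \<in> densities" and t': "t' \<in> densities"
  defines "M \<equiv> density lborel (\<lambda>x. ennreal (s x))"
  shows expectation_score_le: "1 / 2 * rho_drift t t' + 1 / sqrt 2 * (\<integral>x. score (t x) (t' x) \<partial>M)
      \<le> (1 + sqrt 2 / 2) * (hellinger s t)\<^sup>2 - (1 - sqrt 2 / 2) * (hellinger s t')\<^sup>2"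
    and expectation_score_sq_le: "(\<integral>x. (score (t x) (t' x))\<^sup>2 \<partial>M)
      \<le> 6 * ((hellinger s t)\<^sup>2 + (hellinger s t')\<^sup>2)"
proof -
  note D = densitiesD[OF s] densitiesD[OF t] densitiesD[OF t']
  have [measurable]: "s \<in> borel_measurable borel" "t \<in> borel_measurable borel" "t' \<in> borel_measurable borel"
    using D by auto
  have sc: "\<bar>score (t x) (t' x)\<bar> \<le> 1" for x using D by (intro score_abs_le_1)
  then have sc2: "\<bar>(score (t x) (t' x))\<^sup>2\<bar> \<le> 1" for x by (simp add: abs_square_le_1)
  note I1 = integrable_bounded_mult_density[OF s _ sc] and I2 = integrable_bounded_mult_density[OF s _ sc2]
  note Ist = integrable_hellinger[OF s t] and Ist' = integrable_hellinger[OF s t']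
  have "1 / 2 * rho_drift t t' + 1 / sqrt 2 * (\<integral>x. score (t x) (t' x) \<partial>M)
    = (\<integral>x. 1 / 2 * ((sqrt (t' x) - sqrt (t x)) * sqrt ((t x + t' x) / 2))
        + 1 / sqrt 2 * (score (t x) (t' x) * s x) \<partial>lborel)"
    using rho_drift_integral[OF t t'] I1 by (simp add: M_def)
  also have "\<dots> \<le> (\<integral>x. (1 / 2 + sqrt 2 / 4) * (sqrt (s x) - sqrt (t x))\<^sup>2
      - (1 / 2 - sqrt 2 / 4) * (sqrt (s x) - sqrt (t' x))\<^sup>2 + (t' x - t x) / 2 \<partial>lborel)"
    using drift_pointwise[of "sqrt (t _)" "sqrt (t' _)" "sqrt (s _)"] D I1 Ist Ist' rho_drift_integral[OF t t']
    by (intro integral_mono) auto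
  also have "\<dots> = (1 / 2 + sqrt 2 / 4) * (2 * (hellinger s t)\<^sup>2) - (1 / 2 - sqrt 2 / 4) * (2 * (hellinger s t')\<^sup>2)"
    using D Ist Ist' by (simp add: hellinger_sq)
  finally show "1 / 2 * rho_drift t t' + 1 / sqrt 2 * (\<integral>x. score (t x) (t' x) \<partial>M)
      \<le> (1 + sqrt 2 / 2) * (hellinger s t)\<^sup>2 - (1 - sqrt 2 / 2) * (hellinger s t')\<^sup>2"
    by (simp add: algebra_simps)
  have "(\<integral>x. (score (t x) (t' x))\<^sup>2 \<partial>M) = (\<integral>x. (score (t x) (t' x))\<^sup>2 * s x \<partial>lborel)"
    unfolding M_def by (rule I2) measurable
  also have "\<dots> \<le> (\<integral>x. 3 * ((sqrt (s x) - sqrt (t x))\<^sup>2 + (sqrt (s x) - sqrt (t' x))\<^sup>2) \<partial>lborel)"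
    using variance_pointwise[of "sqrt (t _)" "sqrt (t' _)" "sqrt (s _)"] D I2 Ist Ist'
    by (intro integral_mono) auto
  also have "\<dots> = 6 * ((hellinger s t)\<^sup>2 + (hellinger s t')\<^sup>2)"
    using Ist Ist' by (simp add: hellinger_sq)
  finally show "(\<integral>x. (score (t x) (t' x))\<^sup>2 \<partial>M) \<le> 6 * ((hellinger s t)\<^sup>2 + (hellinger s t')\<^sup>2)" .
qed

section \<open>Test statistics against step densities\<close>

text \<open>The expression is Lipschitz in \<open>x\<close> with constant at most
  \<open>P + R\<close>; Young's inequality with parameter \<open>\<eta>\<close> separates
  \<open>\<bar>x - z\<bar>\<close> from \<open>P + R\<close>, so that after integration only a
  squared distance and total masses remain.\<close>

lemma drift_perturb_pointwise:
  fixes x y z \<eta> :: real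
  assumes "0 \<le> x" "0 \<le> y" "0 \<le> z" "0 < \<eta>"
  shows "(y - x) * sqrt ((x\<^sup>2 + y\<^sup>2) / 2)
    \<le> (y - z) * sqrt ((z\<^sup>2 + y\<^sup>2) / 2) + (x - z)\<^sup>2 / (2 * \<eta>) + \<eta> / 2 * (x\<^sup>2 + z\<^sup>2 + 2 * y\<^sup>2)"
proof -
  define P R where "P = sqrt ((x\<^sup>2 + y\<^sup>2) / 2)" and "R = sqrt ((z\<^sup>2 + y\<^sup>2) / 2)"
  have PR: "0 \<le> P" "0 \<le> R" "2 * P\<^sup>2 = x\<^sup>2 + y\<^sup>2" "2 * R\<^sup>2 = z\<^sup>2 + y\<^sup>2"
    "sqrt (x\<^sup>2 + y\<^sup>2) = sqrt 2 * P" "sqrt (z\<^sup>2 + y\<^sup>2) = sqrt 2 * R"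
    by (auto simp: P_def R_def real_sqrt_divide power_divide)
  have "sqrt 2 * P \<le> sqrt 2 * R + \<bar>x - z\<bar>" "sqrt 2 * R \<le> sqrt 2 * P + \<bar>x - z\<bar>"
    using real_sqrt_sum_squares_triangle_ineq[of z "x - z" y 0]
      real_sqrt_sum_squares_triangle_ineq[of x "z - x" y 0] PR
    by (simp_all add: abs_minus_commute)
  then have lip: "sqrt 2 * \<bar>P - R\<bar> \<le> \<bar>x - z\<bar>"
    by (auto simp: abs_if algebra_simps)
  have "(y - z)\<^sup>2 \<le> z\<^sup>2 + y\<^sup>2" using assms by (simp add: power2_diff)
  then have "\<bar>y - z\<bar> \<le> sqrt 2 * R"
    unfolding PR(6)[symmetric] by (intro real_le_rsqrt) simp
  then have "\<bar>y - z\<bar> * \<bar>P - R\<bar> \<le> (sqrt 2 * R) * \<bar>P - R\<bar>" by (rule mult_right_mono) auto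
  also have "\<dots> = R * (sqrt 2 * \<bar>P - R\<bar>)" by simp
  also have "\<dots> \<le> R * \<bar>x - z\<bar>" using lip PR by (intro mult_left_mono) auto
  finally have 1: "(y - z) * (P - R) \<le> R * \<bar>x - z\<bar>"
    using abs_ge_self[of "(y - z) * (P - R)"] by (simp add: abs_mult)
  have 2: "(z - x) * P \<le> \<bar>x - z\<bar> * P" using PR by (intro mult_right_mono) auto
  have "0 \<le> (\<bar>x - z\<bar> - \<eta> * (P + R))\<^sup>2 / (2 * \<eta>)" using assms by simp
  also have "\<dots> = (x - z)\<^sup>2 / (2 * \<eta>) + \<eta> / 2 * (P + R)\<^sup>2 - \<bar>x - z\<bar> * (P + R)"
    using assms by (simp add: power2_diff power_mult_distrib field_simps) (simp add: power2_eq_square algebra_simps)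
  finally have "\<bar>x - z\<bar> * (P + R) \<le> (x - z)\<^sup>2 / (2 * \<eta>) + \<eta> / 2 * (P + R)\<^sup>2" by simp
  also have "(P + R)\<^sup>2 \<le> x\<^sup>2 + z\<^sup>2 + 2 * y\<^sup>2"
    using PR zero_le_power2[of "P - R"] by (simp add: power2_diff power2_sum)
  finally have "\<bar>x - z\<bar> * (P + R) \<le> (x - z)\<^sup>2 / (2 * \<eta>) + \<eta> / 2 * (x\<^sup>2 + z\<^sup>2 + 2 * y\<^sup>2)"
    using assms by (simp add: mult_left_mono)
  moreover have "(y - x) * P = (y - z) * R + (z - x) * P + (y - z) * (P - R)" by (simp add: algebra_simps)
  moreover have "\<bar>x - z\<bar> * (P + R) = \<bar>x - z\<bar> * P + R * \<bar>x - z\<bar>" by (simp add: algebra_simps)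
  ultimately show ?thesis using 1 2 unfolding P_def[symmetric] R_def[symmetric] by linarith
qed

lemma rho_drift_perturb:
  assumes u: "u \<in> densities" and t: "t \<in> densities" and t': "t' \<in> densities" and \<eta>: "0 < \<eta>"
  shows "rho_drift u t' \<le> rho_drift t t' + (hellinger u t)\<^sup>2 / \<eta> + 2 * \<eta>"
proof -
  note D = densitiesD[OF u] densitiesD[OF t] densitiesD[OF t']
  have "rho_drift u t' \<le> (\<integral>x. (sqrt (t' x) - sqrt (t x)) * sqrt ((t x + t' x) / 2)
    + (sqrt (u x) - sqrt (t x))\<^sup>2 / (2 * \<eta>) + \<eta> / 2 * (u x + t x + 2 * t' x) \<partial>lborel)"
    unfolding rho_drift_integral(2)[OF u t']
    using drift_perturb_pointwise[of "sqrt (u _)" "sqrt (t' _)" "sqrt (t _)" \<eta>] \<eta> D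
      rho_drift_integral(1)[OF u t'] rho_drift_integral(1)[OF t t'] integrable_hellinger[OF u t]
    by (intro integral_mono) auto
  also have "\<dots> = rho_drift t t' + (hellinger u t)\<^sup>2 / \<eta> + 2 * \<eta>"
    using D rho_drift_integral[OF t t'] integrable_hellinger[OF u t] by (simp add: hellinger_sq)
  finally show ?thesis .
qed

text \<open>A step density to compare with need not belong to \<open>S\<close>: on almost every sample, replacing \<open>t\<close> by a good approximation from \<open>S\<close> increases the first argument's test
  statistic negligibly, uniformly in the second argument. Where \<open>t\<close> vanishes this uses
  \<open>score c b \<le> score 0 b\<close>, there being no continuity at \<open>(0, 0)\<close>.\<close>

lemma rho_T_approx:
  assumes t: "t \<in> hellinger_closure S" and S: "S \<subseteq> densities"
  obtains N where "N \<in> null_sets lborel"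
    "\<And>X. (\<And>i. i \<in> {1..n} \<Longrightarrow> X i \<notin> N) \<Longrightarrow>
      \<exists>u\<in>S. \<forall>t'\<in>densities. rho_T n X u t' \<le> rho_T n X t t' + 1"
proof -
  have td: "t \<in> densities" using t by (simp add: hellinger_closure_def)
  have "\<forall>k. \<exists>u\<in>S. hellinger t u < 1 / real (Suc k)"
    using t by (simp add: hellinger_closure_def)
  then obtain u where u: "\<And>k. u k \<in> S" "\<And>k. hellinger t (u k) < 1 / real (Suc k)" by metis
  have ud: "u k \<in> densities" for k using u S by auto
  have h0: "0 \<le> hellinger t (u k)" for k
    unfolding hellinger_def by (intro real_sqrt_ge_zero mult_nonneg_nonneg integral_nonneg) auto
  have h: "(\<lambda>k. hellinger t (u k)) \<longlonglongrightarrow> 0"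
    using h0 u(2) by (intro tendsto_sandwich[OF _ _ tendsto_const LIMSEQ_Suc[OF lim_1_over_n]])
      (auto intro!: always_eventually less_imp_le)
  have h2: "(\<lambda>k. (hellinger t (u k))\<^sup>2) \<longlonglongrightarrow> 0"
    using tendsto_power[OF h, of 2] by simp
  \<comment> \<open>Hellinger convergence is L1 convergence of the squared differences, so a
    subsequence converges almost everywhere.\<close>
  have "(\<lambda>k. \<integral>x. norm ((sqrt (t x) - sqrt (u k x))\<^sup>2) \<partial>lborel) \<longlonglongrightarrow> 0"
    using tendsto_mult_left[OF h2, of 2] by (simp add: hellinger_sq)
  then obtain r where r: "strict_mono r"
    "AE x in lborel. (\<lambda>k. (sqrt (t x) - sqrt (u (r k) x))\<^sup>2) \<longlonglongrightarrow> 0"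
    using tendsto_L1_AE_subseq[of lborel "\<lambda>k x. (sqrt (t x) - sqrt (u k x))\<^sup>2"] integrable_hellinger[OF td ud]
    by blast
  then obtain N where N: "N \<in> null_sets lborel"
    "\<And>x. x \<notin> N \<Longrightarrow> (\<lambda>k. (sqrt (t x) - sqrt (u (r k) x))\<^sup>2) \<longlonglongrightarrow> 0"
    by (auto elim!: AE_E3)
  \<comment> \<open>The \<open>n\<close> scores lose \<open>n * \<delta> \<le> 1 / 2\<close> in
    total; \<open>\<eta>\<close> below is chosen so that the drift loses at most the other half of
    the allowed 1.\<close>
  define \<delta> where "\<delta> = 1 / (2 * real (Suc n))"
  have \<delta>: "0 < \<delta>" by (simp add: \<delta>_def)
  have ev: "eventually (\<lambda>k. \<forall>b\<ge>0. score (u (r k) x) b \<le> score (t x) b + \<delta>) sequentially"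
    if x: "x \<notin> N" for x
  proof (cases "t x = 0")
    case True
    \<comment> \<open>For \<open>b > 0\<close> the right side is 1, the largest possible score; for
      \<open>b = 0\<close> it is 0 and the left side is nonpositive.\<close>
    have "score (u (r k) x) b \<le> score 0 b" if "0 \<le> b" for k b
    proof (cases "b = 0")
      case True
      then show ?thesis using densitiesD(2)[OF ud] by (simp add: score_def divide_nonpos_nonneg)
    next
      case False
      then show ?thesis using that abs_le_D1[OF score_abs_le_1[OF densitiesD(2)[OF ud] that, of "r k" x]]
        by (simp add: score_def)
    qed
    then show ?thesis using True \<delta> by (auto intro!: always_eventually add_increasing2)
  next
    case False
    then have pos: "0 < sqrt (t x)" using densitiesD(2)[OF td, of x] by simp
    have "(\<lambda>k. \<bar>sqrt (u (r k) x) - sqrt (t x)\<bar>) \<longlonglongrightarrow> 0"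
      using tendsto_real_sqrt[OF N(2)[OF x]] by (simp add: abs_minus_commute)
    then have lim: "(\<lambda>k. sqrt (u (r k) x)) \<longlonglongrightarrow> sqrt (t x)"
      using LIM_zero_iff tendsto_rabs_zero_iff by blast
    have "(\<lambda>k. 2 * \<bar>sqrt (u (r k) x) - sqrt (t x)\<bar> / sqrt (u (r k) x))
        \<longlonglongrightarrow> 2 * \<bar>sqrt (t x) - sqrt (t x)\<bar> / sqrt (t x)"
      by (intro tendsto_divide tendsto_mult tendsto_rabs tendsto_diff tendsto_const lim) (use pos in simp)
    then have "eventually (\<lambda>k. 2 * \<bar>sqrt (u (r k) x) - sqrt (t x)\<bar> / sqrt (u (r k) x) < \<delta>) sequentially"
      using \<delta> by (intro order_tendstoD) auto
    moreover have "eventually (\<lambda>k. 0 < sqrt (u (r k) x)) sequentially"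
      using order_tendstoD(1)[OF lim pos] .
    ultimately show ?thesis
    proof eventually_elim
      case (elim k)
      show ?case
      proof (intro allI impI)
        fix b :: real assume "0 \<le> b"
        then show "score (u (r k) x) b \<le> score (t x) b + \<delta>"
          using score_perturb[OF densitiesD(2)[OF td] \<open>0 \<le> b\<close>, of "u (r k) x" x] elim by simp
      qed
    qed
  qed
  define \<eta> where "\<eta> = 1 / (8 * real (Suc n))"
  have \<eta>: "0 < \<eta>" by (simp add: \<eta>_def)
  have lim0: "(\<lambda>k. (hellinger t (u (r k)))\<^sup>2 / \<eta>) \<longlonglongrightarrow> 0"
    using tendsto_divide_zero[OF LIMSEQ_subseq_LIMSEQ[OF h2 r(1)]] by (simp add: o_def)
  have evh: "eventually (\<lambda>k. (hellinger t (u (r k)))\<^sup>2 / \<eta> < 2 * \<eta>) sequentially"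
    using \<eta> by (intro order_tendstoD(2)[OF lim0]) simp
  show thesis
  proof (rule that[OF N(1)])
    fix X :: "nat \<Rightarrow> real" assume X: "\<And>i. i \<in> {1..n} \<Longrightarrow> X i \<notin> N"
    have "eventually (\<lambda>k. \<forall>i\<in>{1..n}. \<forall>b\<ge>0. score (u (r k) (X i)) b \<le> score (t (X i)) b + \<delta>) sequentially"
      using X ev by (intro eventually_ball_finite) auto
    with evh have "eventually (\<lambda>k. (hellinger t (u (r k)))\<^sup>2 / \<eta> < 2 * \<eta> \<and>
        (\<forall>i\<in>{1..n}. \<forall>b\<ge>0. score (u (r k) (X i)) b \<le> score (t (X i)) b + \<delta>)) sequentially"
      by (rule eventually_conj)
    then obtain k where k: "(hellinger t (u (r k)))\<^sup>2 / \<eta> < 2 * \<eta>"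
      "\<And>i b. i \<in> {1..n} \<Longrightarrow> 0 \<le> b \<Longrightarrow> score (u (r k) (X i)) b \<le> score (t (X i)) b + \<delta>"
      by (auto simp: eventually_sequentially)
    have "rho_T n X (u (r k)) t' \<le> rho_T n X t t' + 1" if t': "t' \<in> densities" for t'
    proof -
      have "rho_drift (u (r k)) t' \<le> rho_drift t t' + 4 * \<eta>"
        using rho_drift_perturb[OF ud td t' \<eta>, of "r k"] k(1) by (simp add: hellinger_commute)
      then have "n / 2 * rho_drift (u (r k)) t' \<le> n / 2 * (rho_drift t t' + 4 * \<eta>)"
        by (intro mult_left_mono) auto
      also have "\<dots> = n / 2 * rho_drift t t' + 2 * n * \<eta>" by (simp add: algebra_simps)
      also have "2 * n * \<eta> \<le> 1 / 2" by (simp add: \<eta>_def field_simps)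
      finally have 1: "n / 2 * rho_drift (u (r k)) t' \<le> n / 2 * rho_drift t t' + 1 / 2" by simp
      have "(\<Sum>i=1..n. score (u (r k) (X i)) (t' (X i))) \<le> (\<Sum>i=1..n. score (t (X i)) (t' (X i)) + \<delta>)"
        using k(2) densitiesD(2)[OF t'] by (intro sum_mono) auto
      also have "\<dots> = (\<Sum>i=1..n. score (t (X i)) (t' (X i))) + n * \<delta>" by (simp add: sum.distrib)
      also have "n * \<delta> \<le> 1 / 2" by (simp add: \<delta>_def field_simps)
      finally have "1 / sqrt 2 * (\<Sum>i=1..n. score (u (r k) (X i)) (t' (X i)))
          \<le> 1 / sqrt 2 * ((\<Sum>i=1..n. score (t (X i)) (t' (X i))) + 1 / 2)"
        by (intro mult_left_mono) auto
      also have "\<dots> \<le> 1 / sqrt 2 * (\<Sum>i=1..n. score (t (X i)) (t' (X i))) + 1 / 2"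
        by (simp add: distrib_left divide_simps)
      finally show ?thesis using 1 unfolding rho_T_eq[OF ud t'] rho_T_eq[OF td t'] by simp
    qed
    then show "\<exists>u\<in>S. \<forall>t'\<in>densities. rho_T n X u t' \<le> rho_T n X t t' + 1" using u(1) by blast
  qed
qed

text \<open>\<open>u\<close> stands in for \<open>sbar\<close>, which may lie outside
  \<open>S\<close>. A near-minimiser \<open>w\<close> satisfies
  \<open>rho_T n X w u \<le> rho_Upsilon n X S w \<le> p + 1 + 35.7\<close>, while antisymmetry
  gives \<open>rho_T n X w u \<ge> q * (hellinger s w)^2 - p - 1\<close>. Passing to the closure
  through the squared triangle inequality doubles the bound.\<close>

lemma rho_estimate_bound:
  assumes S: "S \<subseteq> densities" and s: "s \<in> densities" and q: "0 \<le> q"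
    and T: "\<And>t'. t' \<in> S \<Longrightarrow> rho_T n X sbar t' \<le> p - q * (hellinger s t')\<^sup>2"
    and u: "u \<in> S" and uT: "\<And>t'. t' \<in> S \<Longrightarrow> rho_T n X u t' \<le> rho_T n X sbar t' + 1"
    and v: "v \<in> hellinger_closure {t \<in> S. rho_Upsilon n X S t \<le> (INF t'\<in>S. rho_Upsilon n X S t') + 35.7}"
  shows "q * (hellinger s v)\<^sup>2 \<le> 4 * p + 80"
proof -
  have bdd: "bdd_above (rho_T n X t ` S)" if "t \<in> S" for t
    using rho_T_abs_le S that by (intro bdd_aboveI2[where M="2 * real n"]) (auto simp: abs_le_iff subset_iff)
  have lower: "rho_T n X t t' \<le> rho_Upsilon n X S t" if "t \<in> S" "t' \<in> S" for t t'
    unfolding rho_Upsilon_def using that bdd by (intro cSUP_upper)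
  have bddU: "bdd_below (rho_Upsilon n X S ` S)"
  proof (rule bdd_belowI2)
    fix t assume t: "t \<in> S"
    have "- (2 * real n) \<le> rho_T n X t t" using rho_T_abs_le[of t t n X] S t by (auto simp: abs_le_iff)
    then show "- (2 * real n) \<le> rho_Upsilon n X S t" using lower[OF t t] by linarith
  qed
  have vd: "v \<in> densities" using v by (simp add: hellinger_closure_def)
  have Uu: "rho_Upsilon n X S u \<le> p + 1"
    unfolding rho_Upsilon_def
  proof (rule cSUP_least)
    fix t' assume t': "t' \<in> S"
    have "0 \<le> q * (hellinger s t')\<^sup>2" using q by simp
    then show "rho_T n X u t' \<le> p + 1" using uT[OF t'] T[OF t'] by linarith
  qed (use u in auto)
  have w: "q * (hellinger s w)\<^sup>2 \<le> 2 * p + 40"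
    if "w \<in> S" "rho_Upsilon n X S w \<le> (INF t'\<in>S. rho_Upsilon n X S t') + 35.7" for w
  proof -
    have "(INF t'\<in>S. rho_Upsilon n X S t') \<le> rho_Upsilon n X S u" using bddU u by (rule cINF_lower)
    then have "rho_T n X w u \<le> p + 1 + 35.7" using lower[OF that(1) u] that(2) Uu by linarith
    moreover have "rho_T n X w u = - rho_T n X u w" by (rule rho_T_antisym) (use S u that in auto)
    ultimately show ?thesis using uT[OF that(1)] T[OF that(1)] by simp
  qed
  show ?thesis
  proof (rule field_le_epsilon)
    fix \<epsilon> :: real assume \<epsilon>: "0 < \<epsilon>"
    \<comment> \<open>Makes \<open>2 * q * d^2 \<le> \<epsilon>\<close>; the \<open>+ 1\<close>
      covers \<open>q = 0\<close>.\<close>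
    define d where "d = sqrt (\<epsilon> / (2 * q + 1))"
    have d: "0 < d" using \<epsilon> q by (simp add: d_def)
    then obtain w where w': "w \<in> S" "rho_Upsilon n X S w \<le> (INF t'\<in>S. rho_Upsilon n X S t') + 35.7"
      "hellinger v w < d"
      using v unfolding hellinger_closure_def by blast
    have "0 \<le> hellinger v w"
      unfolding hellinger_def by (intro real_sqrt_ge_zero mult_nonneg_nonneg integral_nonneg) auto
    then have "(hellinger v w)\<^sup>2 \<le> d\<^sup>2" using w' by (intro power_mono) auto
    also have "d\<^sup>2 = \<epsilon> / (2 * q + 1)" using \<epsilon> q by (simp add: d_def)
    finally have "2 * q * (hellinger v w)\<^sup>2 \<le> 2 * q * (\<epsilon> / (2 * q + 1))" using q by (intro mult_left_mono) auto
    also have "\<dots> \<le> \<epsilon>" using \<epsilon> q by (simp add: field_simps)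
    finally have 1: "2 * q * (hellinger v w)\<^sup>2 \<le> \<epsilon>" .
    have "q * (hellinger s v)\<^sup>2 \<le> q * (2 * (hellinger s w)\<^sup>2 + 2 * (hellinger w v)\<^sup>2)"
      using hellinger_sq_triangle[OF s _ vd, of w] S w'(1) q by (intro mult_left_mono) auto
    also have "\<dots> = 2 * (q * (hellinger s w)\<^sup>2) + 2 * q * (hellinger v w)\<^sup>2"
      by (simp add: hellinger_commute[of w v] algebra_simps)
    also have "\<dots> \<le> 4 * p + 80 + \<epsilon>" using w[OF w'(1,2)] 1 by simp
    finally show "q * (hellinger s v)\<^sup>2 \<le> 4 * p + 80 + \<epsilon>" .
  qed
qed

text \<open>Deviation bound plus drift bound. The slope 1/32 times the factor 6 of
  \<open>expectation_score_sq_le\<close> is small enough for the drift to keep a coefficient of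
  \<open>- 1 / 8\<close>.\<close>

lemma regular_sample_rho_T:
  fixes \<kappa> :: "real \<Rightarrow> 'b" and n :: nat
  assumes s: "s \<in> densities" and t: "t \<in> densities" and t': "t' \<in> decreasing_densities"
    and reg: "real_distribution.regular_sample (density lborel (\<lambda>x. ennreal (s x))) n (1 / 32) L X"
    and L: "0 \<le> L" and n: "0 < n"
    and fin: "finite (range \<kappa>)" and I: "\<And>c. is_interval {x. \<kappa> x = c}"
    and const: "\<And>x y. \<kappa> x = \<kappa> y \<Longrightarrow> t x = t y"
  shows "rho_T n X t t' \<le> 2 * n * (hellinger s t)\<^sup>2 - n / 8 * (hellinger s t')\<^sup>2
    + (4 * card (range \<kappa>) * (32 * L * (1 + ln n) + 4) + 2)"
proof -
  let ?M = "density lborel (\<lambda>x. ennreal (s x))"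
  interpret real_distribution ?M by (rule real_distribution_density[OF s])
  obtain xbar g where g: "antimono_on {xbar<..} g" "t' = (\<lambda>x. g x * indicator {xbar<..} x)"
    and t'd: "t' \<in> densities" using t' by (auto simp: decreasing_densities_def)
  note D = densitiesD[OF s] densitiesD[OF t] densitiesD[OF t'd]
  have [measurable]: "t \<in> borel_measurable borel" "t' \<in> borel_measurable borel" using D by auto
  define f where "f x = score (t x) (t' x)" for x
  have f1: "\<bar>f x\<bar> \<le> 1" for x unfolding f_def using D by (intro score_abs_le_1)
  have fm[measurable]: "f \<in> borel_measurable borel" unfolding f_def by measurable
  \<comment> \<open>\<open>t'\<close> jumps up from 0 at \<open>xbar\<close> and is antitone only on
    either side, so the pieces are cut there, which at most doubles their number.\<close>
  define \<kappa>' where "\<kappa>' x = (\<kappa> x, x \<le> xbar)" for x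
  have sub: "range \<kappa>' \<subseteq> range \<kappa> \<times> (UNIV :: bool set)" by (auto simp: \<kappa>'_def)
  have fin': "finite (range \<kappa>')" using finite_subset[OF sub] fin by simp
  have card': "card (range \<kappa>') \<le> 2 * card (range \<kappa>)"
    using card_mono[OF _ sub] fin by (simp add: card_cartesian_product)
  have I': "is_interval {x. \<kappa>' x = c}" for c
  proof (cases c)
    case (Pair a b)
    have "{x. \<kappa>' x = c} = {x. \<kappa> x = a} \<inter> (if b then {..xbar} else {xbar<..})"
      using Pair by (auto simp: \<kappa>'_def)
    then show ?thesis using I by (simp add: is_interval_Int)
  qed
  have anti: "f y \<le> f x" if "x \<le> y" "\<kappa>' x = \<kappa>' y" for x y
  proof -
    have "t' y \<le> t' x"
      using that g by (auto simp: \<kappa>'_def monotone_on_def indicator_def)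
    moreover have "t x = t y" by (rule const) (use that in \<open>simp add: \<kappa>'_def\<close>)
    ultimately show ?thesis unfolding f_def using D by (simp add: score_mono)
  qed
  let ?W = "4 * card (range \<kappa>) * (32 * L * (1 + ln n) + 4) + 2"
  let ?h = "(hellinger s t)\<^sup>2" and ?h' = "(hellinger s t')\<^sup>2"
  have ln0: "0 \<le> ln n" using n by simp
  have "(\<Sum>i=1..n. f (X i)) - n * (\<integral>x. f x \<partial>?M)
    \<le> 1 / 32 * (n * (\<integral>x. (f x)\<^sup>2 \<partial>?M)) + 2 * card (range \<kappa>') * (L / (1 / 32) * (1 + ln n) + 4) + 2"
    by (rule regular_sample_piecewise_antimono[OF real_distribution_density(2)[OF s] reg _ _ L n fin' I' fm f1 anti]) simp_all
  also have "\<dots> \<le> 1 / 32 * (n * (6 * (?h + ?h'))) + ?W"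
    unfolding add.assoc[symmetric]
  proof (intro add_right_mono add_mono)
    show "1 / 32 * (n * (\<integral>x. (f x)\<^sup>2 \<partial>?M)) \<le> 1 / 32 * (n * (6 * (?h + ?h')))"
      unfolding f_def by (intro mult_left_mono expectation_score_sq_le[OF s t t'd]) auto
    have "real (2 * card (range \<kappa>')) \<le> real (4 * card (range \<kappa>))" using card' by simp
    moreover have "L / (1 / 32) = 32 * L" by simp
    moreover have "0 \<le> 32 * L * (1 + ln n) + 4" using L ln0 by simp
    ultimately show "real (2 * card (range \<kappa>')) * (L / (1 / 32) * (1 + ln n) + 4)
        \<le> real (4 * card (range \<kappa>)) * (32 * L * (1 + ln n) + 4)"
      by (simp only: mult_right_mono)
  qed
  finally have dev: "(\<Sum>i=1..n. f (X i)) \<le> n * (\<integral>x. f x \<partial>?M) + 1 / 32 * (n * (6 * (?h + ?h'))) + ?W"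
    by linarith
  have W: "0 \<le> ?W" using L ln0 by simp
  have sq2: "1 / sqrt 2 = sqrt 2 / 2" by (simp add: field_simps)
  have sqb: "sqrt 2 \<le> 1.42" by (rule real_le_lsqrt) (auto simp: power2_eq_square)
  have "rho_T n X t t' = n / 2 * rho_drift t t' + 1 / sqrt 2 * (\<Sum>i=1..n. f (X i))"
    by (simp add: rho_T_eq[OF t t'd] f_def)
  also have "\<dots> \<le> n / 2 * rho_drift t t' + 1 / sqrt 2 * (n * (\<integral>x. f x \<partial>?M) + 1 / 32 * (n * (6 * (?h + ?h'))) + ?W)"
    using dev by (intro add_left_mono mult_left_mono) auto
  also have "\<dots> = n * (1 / 2 * rho_drift t t' + 1 / sqrt 2 * (\<integral>x. f x \<partial>?M))
      + sqrt 2 / 2 * (6 / 32 * (n * (?h + ?h')) + ?W)"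
    unfolding sq2 by (simp add: algebra_simps)
  also have "\<dots> \<le> n * ((1 + sqrt 2 / 2) * ?h - (1 - sqrt 2 / 2) * ?h') + sqrt 2 / 2 * (6 / 32 * (n * (?h + ?h')) + ?W)"
    unfolding f_def by (intro add_right_mono mult_left_mono expectation_score_le[OF s t t'd]) auto
  also have "\<dots> \<le> 2 * n * ?h - n / 8 * ?h' + ?W"
  proof -
    \<comment> \<open>With \<open>c \<le> 0.71\<close>, the coefficient
      \<open>1 + c + 6 * c / 32\<close> of \<open>A\<close> is below 2 and
      \<open>- 1 + c + 6 * c / 32\<close> of \<open>B\<close> is below
      \<open>- 1 / 8\<close>.\<close>
    define A B c W where "A = n * ?h" and "B = n * ?h'" and "c = sqrt 2 / 2" and "W = ?W"
    have AB: "0 \<le> A" "0 \<le> B" "c \<le> 71 / 100" using sqb by (auto simp: A_def B_def c_def)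
    have "c * A \<le> 71 / 100 * A" "c * B \<le> 71 / 100 * B" by (intro mult_right_mono AB)+
    moreover have "c * W \<le> 1 * W" using AB W by (intro mult_right_mono) (auto simp: W_def)
    ultimately have "A + c * A - B + c * B + 6 / 32 * (c * A) + 6 / 32 * (c * B) + c * W \<le> 2 * A - B / 8 + W"
      using AB by linarith
    then show ?thesis unfolding A_def B_def c_def W_def[symmetric] by (simp add: algebra_simps)
  qed
  finally show ?thesis .
qed

section \<open>Approximation by step densities\<close>

text \<open>Radial projection onto the unit ball of \<open>L\<^sup>2\<close>, which contains the square root of \<open>t\<close>, does not
  increase the distance to that square root.\<close>

lemma hellinger_normalize_le:
  assumes t: "t \<in> densities" and r: "integrable lborel r" "\<And>x. 0 \<le> r x"
    and F: "1 \<le> F" "(\<integral>x. r x \<partial>lborel) = F\<^sup>2"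
  shows "(\<lambda>x. r x / F\<^sup>2) \<in> densities"
    and "(hellinger t (\<lambda>x. r x / F\<^sup>2))\<^sup>2 \<le> 1 / 2 * (\<integral>x. (sqrt (t x) - sqrt (r x))\<^sup>2 \<partial>lborel)"
proof -
  note D = densitiesD[OF t]
  show u: "(\<lambda>x. r x / F\<^sup>2) \<in> densities" using r F by (intro densitiesI) auto
  have sq: "sqrt (r x / F\<^sup>2) = sqrt (r x) / F" for x using F by (simp add: real_sqrt_divide)
  have i1: "integrable lborel (\<lambda>x. sqrt (t x) * sqrt (r x))"
    using integrable_mult_right[OF integrable_sqrt_mult[OF t u], of F] F by (simp add: sq)
  have i2: "integrable lborel (\<lambda>x. (sqrt (t x) - sqrt (r x))\<^sup>2)"
    using D r i1 by (simp add: sqrt_diff_sq)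
  \<comment> \<open>The product of square roots is replaced by
    \<open>(b^2 / F + F * a^2) / 2\<close>, sharp when \<open>b = F * a\<close>. The bracket then
    integrates to \<open>- (F - 1)^2\<close>.\<close>
  have pt: "(sqrt (t x) - sqrt (r x / F\<^sup>2))\<^sup>2 \<le> (sqrt (t x) - sqrt (r x))\<^sup>2
      + (r x / F\<^sup>2 - r x + (r x / F + F * t x) * (1 - 1 / F))" for x
  proof -
    define a b where "a = sqrt (t x)" and "b = sqrt (r x)"
    have ab: "t x = a\<^sup>2" "r x = b\<^sup>2" "0 \<le> a" "0 \<le> b" using D(2) r(2) by (auto simp: a_def b_def)
    have "0 \<le> (b - F * a)\<^sup>2 / F" using F by simp
    also have "\<dots> = b\<^sup>2 / F + F * a\<^sup>2 - 2 * (a * b)" using F by (simp add: power2_eq_square field_simps)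
    finally have "2 * (a * b) * (1 - 1 / F) \<le> (b\<^sup>2 / F + F * a\<^sup>2) * (1 - 1 / F)"
      using F by (intro mult_right_mono) auto
    moreover have "(a - b / F)\<^sup>2 = (a - b)\<^sup>2 + (b\<^sup>2 / F\<^sup>2 - b\<^sup>2 + 2 * (a * b) * (1 - 1 / F))"
      by (simp add: power2_diff power_divide algebra_simps)
    ultimately have "(a - b / F)\<^sup>2 \<le> (a - b)\<^sup>2 + (b\<^sup>2 / F\<^sup>2 - b\<^sup>2 + (b\<^sup>2 / F + F * a\<^sup>2) * (1 - 1 / F))"
      by simp
    then show ?thesis unfolding ab(1,2)[symmetric] by (simp only: sq a_def b_def)
  qed
  have "(\<integral>x. (sqrt (t x) - sqrt (r x / F\<^sup>2))\<^sup>2 \<partial>lborel) \<le> (\<integral>x. (sqrt (t x) - sqrt (r x))\<^sup>2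
      + (r x / F\<^sup>2 - r x + (r x / F + F * t x) * (1 - 1 / F)) \<partial>lborel)"
    using pt i2 r D integrable_hellinger[OF t u] by (intro integral_mono) auto
  also have "\<dots> = (\<integral>x. (sqrt (t x) - sqrt (r x))\<^sup>2 \<partial>lborel) + (F\<^sup>2 / F\<^sup>2 - F\<^sup>2 + (F\<^sup>2 / F + F) * (1 - 1 / F))"
    using i2 r D F by simp
  also have "F\<^sup>2 / F\<^sup>2 - F\<^sup>2 + (F\<^sup>2 / F + F) * (1 - 1 / F) = - (F - 1)\<^sup>2"
    using F by (simp add: power2_eq_square field_simps)
  also have "(\<integral>x. (sqrt (t x) - sqrt (r x))\<^sup>2 \<partial>lborel) + - (F - 1)\<^sup>2 \<le> (\<integral>x. (sqrt (t x) - sqrt (r x))\<^sup>2 \<partial>lborel)"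
    by simp
  finally show "(hellinger t (\<lambda>x. r x / F\<^sup>2))\<^sup>2 \<le> 1 / 2 * (\<integral>x. (sqrt (t x) - sqrt (r x))\<^sup>2 \<partial>lborel)"
    by (simp add: hellinger_sq)
qed

text \<open>The pieces are the level sets of \<open>sqrt t\<close> rounded up to \<open>D\<close> equispaced levels. Since only the
  variation on each piece is controlled, the lengths of the pieces enter through their sum \<open>b - a\<close>.\<close>

lemma step_approximation:
  assumes t: "t \<in> bounded_decreasing_densities Mb" and D: "1 \<le> (D::nat)"
  obtains sb and \<kappa> :: "real \<Rightarrow> int" where "sb \<in> decreasing_densities" "finite (range \<kappa>)"
    "card (range \<kappa>) \<le> D + 3" "\<And>c. is_interval {x. \<kappa> x = c}" "\<And>x y. \<kappa> x = \<kappa> y \<Longrightarrow> sb x = sb y"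
    "(hellinger t sb)\<^sup>2 \<le> Mb / (2 * (real D)\<^sup>2)"
proof -
  from t obtain a b where td: "t \<in> densities" and bdd: "bounded (range t)" and ab: "a < b"
    and out: "\<And>x. x \<notin> {a..b} \<Longrightarrow> t x = 0" and anti: "antimono_on {a<..<b} t"
    and var: "ereal (b - a) * (variation_on {a..b} (\<lambda>x. sqrt (t x)))\<^sup>2 \<le> ereal Mb"
    by (auto simp: bounded_decreasing_densities_def)
  note Dt = densitiesD[OF td]
  have [measurable]: "t \<in> borel_measurable borel" by (fact Dt)
  obtain c where c: "\<And>x. t x \<le> c" using bdd by (auto simp: bounded_iff abs_le_iff)
  let ?f = "\<lambda>x. sqrt (t x)" and ?I = "{a<..<b}"
  define m v V where "m = (INF x\<in>?I. ?f x)" and "v = (SUP x\<in>?I. ?f x)" and "V = v - m"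
  have ne: "?I \<noteq> {}" using ab by simp
  have bb: "bdd_below (?f ` ?I)" "bdd_above (?f ` ?I)"
    using Dt(2) c by (auto intro!: bdd_belowI2[where m=0] bdd_aboveI2[where M="sqrt c"])
  have mv: "m \<le> ?f x" "?f x \<le> v" if "x \<in> ?I" for x
    using that bb unfolding m_def v_def by (auto intro: cINF_lower cSUP_upper)
  have m0: "0 \<le> m" unfolding m_def using ne Dt(2) by (intro cINF_greatest) auto
  have V0: "0 \<le> V" using mv[of "(a + b) / 2"] ab by (simp add: V_def)
  have "(SUP x\<in>?I. ereal (?f x)) = ereal v" "(INF x\<in>?I. ereal (?f x)) = ereal m"
  proof -
    have "(SUP x\<in>?I. ereal (?f x)) \<le> ereal v" using mv by (intro SUP_least) auto
    moreover have "ereal (?f ((a + b) / 2)) \<le> (SUP x\<in>?I. ereal (?f x))" using ab by (intro SUP_upper) auto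
    ultimately have "\<bar>SUP x\<in>?I. ereal (?f x)\<bar> \<noteq> \<infinity>" by auto
    then show "(SUP x\<in>?I. ereal (?f x)) = ereal v" unfolding v_def by (rule ereal_SUP[symmetric])
    have "ereal m \<le> (INF x\<in>?I. ereal (?f x))" using mv by (intro INF_greatest) auto
    moreover have "(INF x\<in>?I. ereal (?f x)) \<le> ereal (?f ((a + b) / 2))" using ab by (intro INF_lower) auto
    ultimately have "\<bar>INF x\<in>?I. ereal (?f x)\<bar> \<noteq> \<infinity>" by auto
    then show "(INF x\<in>?I. ereal (?f x)) = ereal m" unfolding m_def by (rule ereal_INF[symmetric])
  qed
  then have VM: "(b - a) * V\<^sup>2 \<le> Mb"
    using var by (simp add: variation_on_def V_def interior_atLeastAtMost_real power2_eq_square)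
  define w where "w = V / D"
  have w0: "0 \<le> w" using V0 by (simp add: w_def)
  \<comment> \<open>If \<open>V = 0\<close>, division by zero makes \<open>k\<close> vanish and
    \<open>g\<close> is the constant \<open>m\<close>, as it should be.\<close>
  define k where "k x = \<lfloor>D * (?f x - m) / V\<rfloor>" for x
  \<comment> \<open>Rounding up gives \<open>r\<close> total mass at least 1, the hypothesis
    \<open>1 \<le> F\<close> of the normalisation.\<close>
  define g where "g x = m + w * (k x + 1)" for x
  have k: "0 \<le> k x" "k x \<le> D" if x: "x \<in> ?I" for x
  proof -
    show "0 \<le> k x" using mv[OF x] V0 by (simp add: k_def)
    have "D * (?f x - m) / V \<le> D"
      using mv[OF x] V0 by (cases "V = 0") (auto simp: divide_le_eq V_def mult_left_mono)
    then show "k x \<le> D" by (simp add: k_def floor_le_iff)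
  qed
  have g: "?f x \<le> g x" "g x \<le> ?f x + w" "0 \<le> g x" if x: "x \<in> ?I" for x
  proof -
    have "?f x \<le> g x \<and> g x \<le> ?f x + w"
    proof (cases "V = 0")
      case True
      then show ?thesis using mv[OF x] by (simp add: g_def w_def V_def)
    next
      case False
      then have wp: "0 < w" using V0 D by (simp add: w_def)
      have eq: "D * (?f x - m) / V = (?f x - m) / w" using D by (simp add: w_def)
      have "k x \<le> (?f x - m) / w" "(?f x - m) / w < k x + 1" unfolding k_def eq by linarith+
      then show ?thesis using wp by (simp add: g_def field_simps)
    qed
    then show "?f x \<le> g x" "g x \<le> ?f x + w" by auto
    show "0 \<le> g x" unfolding g_def using m0 w0 k[OF x] by simp
  qed
  have kanti: "k y \<le> k x" if "x \<in> ?I" "y \<in> ?I" "x \<le> y" for x y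
    unfolding k_def using anti that V0
    by (intro floor_mono divide_right_mono mult_left_mono) (auto simp: monotone_on_def)
  define r where "r x = (g x)\<^sup>2 * indicator ?I x" for x
  have [measurable]: "r \<in> borel_measurable borel" unfolding r_def g_def k_def by measurable
  have sqr: "sqrt (r x) = g x * indicator ?I x" for x
    using g(3)[of x] by (auto simp: r_def indicator_def)
  have r0: "0 \<le> r x" for x by (simp add: r_def)
  have c0: "0 \<le> c" using Dt(2)[of 0] c[of 0] by linarith
  have gle: "g x \<le> sqrt c + w" if "x \<in> ?I" for x
    using g(2)[OF that] c[of x] real_sqrt_le_mono[of "t x" c] by linarith
  have intI: "integrable lborel (\<lambda>x. K * indicator ?I x :: real)" for K
    using ab by (intro Bochner_Integration.integrable_mult_right integrable_real_indicator) auto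
  have ri: "integrable lborel r"
  proof (rule Bochner_Integration.integrable_bound[OF intI[of "(sqrt c + w)\<^sup>2"]])
    show "AE x in lborel. norm (r x) \<le> norm ((sqrt c + w)\<^sup>2 * indicator ?I x)"
      using g(3) gle by (auto simp: r_def indicator_def intro!: power_mono)
  qed measurable
  \<comment> \<open>\<open>t\<close> may be nonzero at \<open>a\<close> and \<open>b\<close>, where
    \<open>r\<close> vanishes.\<close>
  have AEI: "AE x in lborel. x \<noteq> a \<and> x \<noteq> b"
    using AE_lborel_singleton[of a] AE_lborel_singleton[of b] by eventually_elim auto
  have out': "x \<notin> ?I \<Longrightarrow> x \<noteq> a \<and> x \<noteq> b \<Longrightarrow> t x = 0" for x using out[of x] by auto
  have R1: "1 \<le> (\<integral>x. r x \<partial>lborel)"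
  proof -
    have "(\<integral>x. t x \<partial>lborel) \<le> (\<integral>x. r x \<partial>lborel)"
    proof (rule integral_mono_AE[OF Dt(3) ri])
      show "AE x in lborel. t x \<le> r x"
        using AEI
      proof eventually_elim
        case (elim x)
        show ?case
        proof (cases "x \<in> ?I")
          case True
          have "(?f x)\<^sup>2 \<le> (g x)\<^sup>2" using g(1)[OF True] Dt(2)[of x] by (intro power_mono) auto
          then show ?thesis using True Dt(2)[of x] by (simp add: r_def)
        next
          case False
          then show ?thesis using out'[of x] elim r0[of x] by simp
        qed
      qed
    qed
    then show ?thesis using Dt by simp
  qed
  define F where "F = sqrt (\<integral>x. r x \<partial>lborel)"
  have F: "1 \<le> F" "(\<integral>x. r x \<partial>lborel) = F\<^sup>2" using R1 by (auto simp: F_def)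
  define sb where "sb x = r x / F\<^sup>2" for x
  have sbd: "sb \<in> densities"
    unfolding sb_def[abs_def] using td ri r0 F by (rule hellinger_normalize_le(1))
  have "(\<integral>x. (sqrt (t x) - sqrt (r x))\<^sup>2 \<partial>lborel) \<le> (\<integral>x. w\<^sup>2 * indicator ?I x \<partial>lborel)"
  proof (rule integral_mono_AE'[OF intI])
    show "AE x in lborel. (sqrt (t x) - sqrt (r x))\<^sup>2 \<le> w\<^sup>2 * indicator ?I x"
      using AEI
    proof eventually_elim
      case (elim x)
      show ?case
      proof (cases "x \<in> ?I")
        case True
        then have "\<bar>sqrt (t x) - g x\<bar> \<le> \<bar>w\<bar>" using g[OF True] w0 by auto
        then show ?thesis using True by (simp add: sqr abs_le_square_iff)
      next
        case False
        then show ?thesis using out'[of x] elim by (simp add: sqr)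
      qed
    qed
  qed auto
  also have "\<dots> = w\<^sup>2 * (b - a)" using ab by simp
  also have "\<dots> = (b - a) * V\<^sup>2 / (real D)\<^sup>2" by (simp add: w_def power_divide)
  also have "\<dots> \<le> Mb / (real D)\<^sup>2" using VM by (intro divide_right_mono) auto
  finally have "(\<integral>x. (sqrt (t x) - sqrt (r x))\<^sup>2 \<partial>lborel) \<le> Mb / (real D)\<^sup>2" .
  then have hell: "(hellinger t sb)\<^sup>2 \<le> Mb / (2 * (real D)\<^sup>2)"
    using hellinger_normalize_le(2)[OF td ri r0 F] unfolding sb_def[abs_def] by simp
  have sbanti: "antimono_on {a<..} sb"
  proof (rule monotone_onI)
    fix x y assume xy: "x \<in> {a<..}" "y \<in> {a<..}" "x \<le> y"
    have "r y \<le> r x"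
    proof (cases "y < b")
      case True
      then have "g y \<le> g x" unfolding g_def using xy kanti[of x y] w0
        by (intro add_left_mono mult_left_mono) auto
      then show ?thesis using True xy g(3)[of y] by (auto simp: r_def intro!: power_mono)
    next
      case False
      then show ?thesis using r0[of x] by (simp add: r_def)
    qed
    then show "sb y \<le> sb x" unfolding sb_def by (intro divide_right_mono) auto
  qed
  have sbout: "sb = (\<lambda>x. sb x * indicator {a<..} x)"
    by (auto simp: sb_def r_def indicator_def fun_eq_iff)
  have "(\<integral>\<^sup>+x\<in>{a<..}. ennreal (sb x) \<partial>lborel) = (\<integral>\<^sup>+x. ennreal (sb x) \<partial>lborel)"
    by (intro nn_integral_cong) (auto simp: sb_def r_def indicator_def)
  also have "\<dots> = 1" using sbd by (simp add: densities_def)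
  finally have "sb \<in> decreasing_densities"
    unfolding decreasing_densities_def using sbd sbanti sbout densitiesD(2)[OF sbd] by blast
  moreover
  \<comment> \<open>The outside consists of two intervals, hence two labels; together with the
    \<open>D + 1\<close> values of \<open>k\<close> (level \<open>D\<close> occurs where
    \<open>sqrt t\<close> attains its supremum) this makes \<open>D + 3\<close>.\<close>
  define \<kappa> where "\<kappa> x = (if x \<le> a then -1 else if b \<le> x then -2 else k x)" for x
  have "\<kappa> x \<in> {-2..int D}" for x using k[of x] by (auto simp: \<kappa>_def)
  then have sub: "range \<kappa> \<subseteq> {-2..int D}" by blast
  have "finite (range \<kappa>)" using finite_subset[OF sub] by simp
  moreover have "card (range \<kappa>) \<le> D + 3" using card_mono[OF _ sub] by simp
  moreover have "is_interval {x. \<kappa> x = c}" for c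
    unfolding is_interval_1
  proof (intro ballI allI impI)
    fix p q x assume *: "p \<in> {x. \<kappa> x = c}" "q \<in> {x. \<kappa> x = c}" "p \<le> x \<and> x \<le> q"
    consider "p \<le> a" | "b \<le> p" | "p \<in> ?I" by force
    then have "\<kappa> x = c"
    proof cases
      case 1
      then have "c = -1" using * by (auto simp: \<kappa>_def)
      then have "q \<le> a" using * k(1)[of q] by (auto simp: \<kappa>_def split: if_splits)
      then show ?thesis using * \<open>c = -1\<close> by (auto simp: \<kappa>_def)
    next
      case 2
      then have "c = -2" "b \<le> x" using * ab by (auto simp: \<kappa>_def)
      then show ?thesis using ab by (auto simp: \<kappa>_def)
    next
      case 3
      then have p: "c = k p" using * by (auto simp: \<kappa>_def)
      then have q: "q \<in> ?I" using * k(1)[OF 3] 3 by (auto simp: \<kappa>_def split: if_splits)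
      then have x: "x \<in> ?I" using * 3 by auto
      have "c = k q" using * q by (auto simp: \<kappa>_def)
      then have "k x = c" using p kanti[OF 3 x] kanti[OF x q] * by auto
      then show ?thesis using x by (auto simp: \<kappa>_def)
    qed
    then show "x \<in> {x. \<kappa> x = c}" by simp
  qed
  moreover have "sb x = sb y" if "\<kappa> x = \<kappa> y" for x y
  proof -
    have "x \<in> ?I \<longleftrightarrow> y \<in> ?I" "x \<in> ?I \<Longrightarrow> k x = k y"
      using that k(1)[of x] k(1)[of y] by (auto simp: \<kappa>_def split: if_splits)
    then show ?thesis by (cases "x \<in> ?I") (auto simp: sb_def r_def g_def)
  qed
  ultimately show thesis using hell that by blast
qed

text \<open>The uniform density on \<open>[0,1]\<close> has zero variation. Nonemptiness makes the
  infimum in \<open>hellinger_set\<close> a genuine one.\<close>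

lemma bounded_decreasing_densities_nonempty:
  assumes "0 \<le> Mb"
  shows "bounded_decreasing_densities Mb \<noteq> {}"
proof -
  define t :: "real \<Rightarrow> real" where "t = indicator {0..1}"
  have "t \<in> densities" by (rule densitiesI) (auto simp: t_def)
  moreover have "bounded (range t)" by (auto simp: t_def bounded_iff indicator_def intro!: exI[of _ 1])
  moreover have "variation_on {0..1} (\<lambda>x. sqrt (t x)) = 0"
  proof -
    have "sqrt (t x) = 1" if "x \<in> {0<..<1}" for x using that by (auto simp: t_def)
    then have "(SUP x\<in>{0<..<1}. ereal (sqrt (t x))) = (SUP x\<in>{0<..<1::real}. 1)"
      "(INF x\<in>{0<..<1}. ereal (sqrt (t x))) = (INF x\<in>{0<..<1::real}. 1)"
      by (auto intro!: SUP_cong INF_cong simp: one_ereal_def)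
    then show ?thesis by (simp add: variation_on_def interior_atLeastAtMost_real)
  qed
  moreover have "antimono_on {0<..<1} t" by (auto simp: monotone_on_def t_def)
  ultimately have "\<exists>a b. a < b \<and> (\<forall>x. x \<notin> {a..b} \<longrightarrow> t x = 0) \<and> antimono_on {a<..<b} t \<and>
      ereal (b - a) * (variation_on {a..b} (\<lambda>x. sqrt (t x)))\<^sup>2 \<le> ereal Mb"
    using assms by - (rule exI[of _ 0], rule exI[of _ 1], auto simp: t_def power2_eq_square)
  then have "t \<in> bounded_decreasing_densities Mb"
    using \<open>t \<in> densities\<close> \<open>bounded (range t)\<close> by (simp add: bounded_decreasing_densities_def)
  then show ?thesis by blast
qed

section \<open>Risk of the estimator\<close>

text \<open>On regular samples \<open>rho_estimate_bound\<close> applies with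
  \<open>q = n / 8\<close>; on the others the loss is at most 1 and the probability at most
  \<open>8 / n\<close>.\<close>

lemma rho_estimator_risk:
  fixes n D :: nat
  defines "l \<equiv> ln (real n)"
  assumes n: "3 \<le> n" and s: "s \<in> densities" and D: "1 \<le> D"
    and est: "rho_estimator n decreasing_densities shat"
    and t: "t \<in> bounded_decreasing_densities Mb"
  shows "(\<integral>X. (hellinger s (shat X))\<^sup>2 \<partial>(\<Pi>\<^sub>M i\<in>{1..n}. density lborel (\<lambda>x. ennreal (s x))))
    \<le> 128 * (hellinger s t)\<^sup>2 + 64 * (Mb / (real D)\<^sup>2) + 140000 * (real D * l\<^sup>2 / n)"
proof -
  let ?M = "density lborel (\<lambda>x. ennreal (s x))"
  define P where "P = (\<Pi>\<^sub>M i\<in>{1..n}. ?M)"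
  \<comment> \<open>Makes \<open>8 * n ^ 3 * exp (- L)\<close> equal to
    \<open>8 / n\<close>.\<close>
  define L where "L = 4 * l"
  interpret real_distribution ?M by (rule real_distribution_density[OF s])
  interpret P: prob_space P unfolding P_def by (rule prob_space_PiM) (rule prob_space_axioms)
  have "exp 1 \<le> real n" using n exp_le by linarith
  then have l1: "1 \<le> l" using n by (simp add: l_def ln_ge_iff)
  obtain S where S: "S \<subseteq> decreasing_densities" "decreasing_densities \<subseteq> hellinger_closure S"
    and shat: "\<And>X. X \<in> space (\<Pi>\<^sub>M i\<in>{1..n}. borel) \<Longrightarrow> shat X \<in> hellinger_closure
      {t \<in> S. rho_Upsilon n X S t \<le> (INF t'\<in>S. rho_Upsilon n X S t') + 35.7}"
    using est unfolding rho_estimator_def by blast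
  have dd: "decreasing_densities \<subseteq> densities" by (auto simp: decreasing_densities_def)
  then have Sd: "S \<subseteq> densities" using S by blast
  obtain sb and \<kappa> :: "real \<Rightarrow> int" where sb: "sb \<in> decreasing_densities"
    and \<kappa>: "finite (range \<kappa>)" "card (range \<kappa>) \<le> D + 3" "\<And>c. is_interval {x. \<kappa> x = c}"
      "\<And>x y. \<kappa> x = \<kappa> y \<Longrightarrow> sb x = sb y"
    and hsb: "(hellinger t sb)\<^sup>2 \<le> Mb / (2 * (real D)\<^sup>2)"
    using step_approximation[OF t D] by blast
  have sbd: "sb \<in> densities" using sb dd by auto
  have td: "t \<in> densities" using t by (auto simp: bounded_decreasing_densities_def)
  have "sb \<in> hellinger_closure S" using sb S by blast
  then obtain N where N: "N \<in> null_sets lborel"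
    "\<And>X. (\<And>i. i \<in> {1..n} \<Longrightarrow> X i \<notin> N) \<Longrightarrow>
      \<exists>u\<in>S. \<forall>t'\<in>densities. rho_T n X u t' \<le> rho_T n X sb t' + 1"
    using rho_T_approx[OF _ Sd, of sb n] by blast
  let ?h = "(hellinger s sb)\<^sup>2"
  define W where "W = 4 * card (range \<kappa>) * (32 * L * (1 + ln n) + 4) + 2"
  have good: "(hellinger s (shat X))\<^sup>2 \<le> 64 * ?h + (32 * W + 640) / n"
    if X: "X \<in> space P" "\<forall>i\<in>{1..n}. X i \<notin> N" and reg: "regular_sample n (1 / 32) L X" for X
  proof -
    obtain u where u: "u \<in> S" "\<And>t'. t' \<in> densities \<Longrightarrow> rho_T n X u t' \<le> rho_T n X sb t' + 1"
      using N(2)[of X] X by blast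
    have "real n / 8 * (hellinger s (shat X))\<^sup>2 \<le> 4 * (2 * n * ?h + W) + 80"
    proof (rule rho_estimate_bound[OF Sd s _ _ u(1), where sbar = sb])
      show "shat X \<in> hellinger_closure
          {t \<in> S. rho_Upsilon n X S t \<le> (INF t'\<in>S. rho_Upsilon n X S t') + 35.7}"
        using X by (intro shat) (simp add: P_def space_PiM)
      fix t' assume t': "t' \<in> S"
      show "rho_T n X u t' \<le> rho_T n X sb t' + 1" using u(2) t' Sd by blast
      have "rho_T n X sb t' \<le> 2 * n * ?h - n / 8 * (hellinger s t')\<^sup>2 + W"
        unfolding W_def
        by (rule regular_sample_rho_T[OF s sbd _ reg _ _ \<kappa>(1,3,4)]) (use l1 n t' S in \<open>auto simp: L_def\<close>)
      then show "rho_T n X sb t' \<le> 2 * n * ?h + W - real n / 8 * (hellinger s t')\<^sup>2" by simp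
    qed simp
    then show ?thesis using n by (simp add: field_simps)
  qed
  define K where "K = 64 * ?h + (32 * W + 640) / n"
  define bad where "bad = {X \<in> space P. \<not> regular_sample n (1 / 32) L X}"
  have bad: "bad \<in> sets P" "P.prob bad \<le> 8 / n"
  proof -
    show "bad \<in> sets P" unfolding bad_def P_def
      by (rule prob_not_regular_sample) (use n in auto)
    have "P.prob bad \<le> 8 * real n ^ 3 * exp (- L)" unfolding bad_def P_def
      by (rule prob_not_regular_sample) (use n in auto)
    also have "exp (- L) = 1 / real n ^ 4"
      using n by (simp add: L_def l_def exp_minus exp_of_nat_mult[of 4, simplified] divide_simps)
    also have "8 * real n ^ 3 * (1 / real n ^ 4) = 8 / n"
      using n by (simp add: power_eq_if)
    finally show "P.prob bad \<le> 8 / n" .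
  qed
  have "0 \<le> W" using l1 by (simp add: W_def L_def l_def)
  then have K0: "0 \<le> K" by (simp add: K_def)
  \<comment> \<open>The rule asks for an integrable, almost everywhere nonnegative majorant: a
    Bochner integral that fails to exist is 0.\<close>
  have "(\<integral>X. (hellinger s (shat X))\<^sup>2 \<partial>P) \<le> (\<integral>X. K + indicator bad X \<partial>P)"
  proof (rule integral_mono_AE')
    show "integrable P (\<lambda>X. K + indicator bad X)"
      using bad by (intro Bochner_Integration.integrable_add integrable_real_indicator) (auto simp: P.emeasure_eq_measure)
    have "AE x in lborel. x \<notin> N" by (rule AE_not_in[OF N(1)])
    then have "AE x in ?M. x \<notin> N"
      using densitiesD(1)[OF s] by (subst AE_density) auto
    then have "AE X in P. X i \<notin> N" if "i \<in> {1..n}" for i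
      unfolding P_def using that prob_space_axioms by (intro AE_PiM_component) auto
    then have "AE X in P. \<forall>i\<in>{1..n}. X i \<notin> N" by (intro eventually_ball_finite) auto
    then show "AE X in P. (hellinger s (shat X))\<^sup>2 \<le> K + indicator bad X"
      using AE_space
    proof eventually_elim
      case (elim X)
      show ?case
      proof (cases "X \<in> bad")
        case True
        have "shat X \<in> densities"
          using shat[of X] elim by (simp add: P_def space_PiM hellinger_closure_def)
        then show ?thesis using True hellinger_sq_le_1[OF s] K0 by (simp add: add_increasing)
      next
        case False
        then show ?thesis using good[of X] elim by (simp add: bad_def K_def)
      qed
    qed
    show "AE X in P. 0 \<le> K + indicator bad X" using K0 by simp
  qed
  also have "\<dots> = K + P.prob bad"
    using bad P.prob_space by (subst Bochner_Integration.integral_add)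
      (auto intro!: integrable_real_indicator simp: P.emeasure_eq_measure)
  also have "\<dots> \<le> K + 8 / n" using bad by simp
  also have "\<dots> = 64 * ?h + (32 * W + 648) / n" by (simp add: K_def add_divide_distrib)
  also have "\<dots> \<le> 64 * (2 * (hellinger s t)\<^sup>2 + Mb / (real D)\<^sup>2) + 140000 * (real D * l\<^sup>2) / n"
  proof (intro add_mono mult_left_mono divide_right_mono)
    show "?h \<le> 2 * (hellinger s t)\<^sup>2 + Mb / (real D)\<^sup>2"
      using hellinger_sq_triangle[OF s td sbd] hsb by simp
    have ll: "l \<le> l\<^sup>2" "1 \<le> l\<^sup>2" using l1 by (auto simp: power2_eq_square mult_left_le one_le_power[of l 2, simplified power2_eq_square])
    \<comment> \<open>Here 260 = 128 + 128 + 4 and \<open>4 * (D + 3) \<le> 16 * D\<close>, so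
      \<open>W\<close> is at most 4160 times \<open>D * l^2\<close>, plus 2; multiplying by 32 and
      absorbing constants gives 140000.\<close>
    have "32 * L * (1 + ln n) + 4 \<le> 260 * l\<^sup>2"
      using ll by (simp add: L_def l_def[symmetric] power2_eq_square algebra_simps)
    moreover have "real (4 * card (range \<kappa>)) \<le> 16 * real D" using \<kappa>(2) D by linarith
    ultimately have "real (4 * card (range \<kappa>)) * (32 * L * (1 + ln n) + 4) \<le> (16 * real D) * (260 * l\<^sup>2)"
      using l1 by (intro mult_mono) (auto simp: L_def l_def)
    then have "W \<le> 4160 * (real D * l\<^sup>2) + 2" by (simp add: W_def algebra_simps)
    moreover have "1 \<le> real D * l\<^sup>2" using mult_mono[of 1 "real D" 1 "l\<^sup>2"] D ll by simp
    ultimately show "32 * W + 648 \<le> 140000 * (real D * l\<^sup>2)" by linarith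
  qed auto
  finally show ?thesis by (simp add: P_def algebra_simps)
qed

text \<open>With \<open>y\<close> the cube root of \<open>n * Mb\<close>, both
  \<open>Mb / y^2\<close> and \<open>y / n\<close> equal \<open>A\<close> for
  \<open>y \<noteq> 0\<close>. The \<open>+ 1\<close> keeps \<open>D\<close> positive when
  \<open>Mb = 0\<close> and costs \<open>l^2 / n\<close>, at most \<open>l ^ 3 / n\<close> because
  \<open>l \<ge> 1\<close>.\<close>

lemma rate_of_pieces:
  fixes n :: nat and Mb :: real
  defines "l \<equiv> ln (real n)" and "D \<equiv> nat \<lfloor>(n * Mb) powr (1 / 3)\<rfloor> + 1"
  defines "\<rho> \<equiv> max (Mb powr (1 / 3) * real n powr (- 2 / 3) * l\<^sup>2) (1 / n * l ^ 3)"
  assumes n: "3 \<le> n" and Mb: "0 \<le> Mb"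
  shows "64 * (Mb / (real D)\<^sup>2) + 140000 * (real D * l\<^sup>2 / n) \<le> 300000 * \<rho>"
proof -
  have "exp 1 \<le> real n" using n exp_le by linarith
  then have l1: "1 \<le> l" using n by (simp add: l_def ln_ge_iff)
  define A where "A = Mb powr (1 / 3) * real n powr (- 2 / 3)"
  define y where "y = (n * Mb) powr (1 / 3)"
  have n0: "0 < real n" using n by simp
  have yA: "y / n = A"
  proof -
    have "real n powr (1 / 3) / n = real n powr (1 / 3 - 1)"
      using n0 by (subst powr_diff) simp
    then have "real n powr (1 / 3) / n = real n powr (- 2 / 3)" by simp
    moreover have "y / n = Mb powr (1 / 3) * (real n powr (1 / 3) / n)"
      using Mb by (simp add: y_def powr_mult)
    ultimately show ?thesis by (simp only: A_def)
  qed
  have y0: "0 \<le> y" by (simp add: y_def)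
  have Dy: "y < D" "D \<le> y + 1" using y0 unfolding D_def y_def[symmetric] by linarith+
  have y3: "y ^ 3 = n * Mb"
    using Mb n0 by (cases "Mb = 0") (simp_all add: y_def powr_powr flip: powr_realpow)
  have A0: "0 \<le> A" by (simp add: A_def)
  have "Mb / (real D)\<^sup>2 \<le> A"
  proof (cases "y = 0")
    case True
    then have "Mb = 0" using y3 n0 by simp
    then show ?thesis using A0 by simp
  next
    case False
    have "Mb / (real D)\<^sup>2 \<le> Mb / y\<^sup>2"
      using Mb y0 False Dy by (intro divide_left_mono power_mono mult_pos_pos zero_less_power) auto
    also have "\<dots> = (n * Mb) / (n * y\<^sup>2)" using n0 by simp
    also have "\<dots> = y / n"
      unfolding y3[symmetric] using False n0 by (simp add: power2_eq_square power3_eq_cube)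
    finally show ?thesis by (simp add: yA)
  qed
  moreover have ll: "1 \<le> l\<^sup>2" "l\<^sup>2 \<le> l ^ 3" using l1 by (auto intro: power_increasing one_le_power)
  moreover have "A \<le> A * l\<^sup>2" using mult_left_mono[OF ll(1) A0] by simp
  moreover have "A * l\<^sup>2 \<le> \<rho>" by (simp add: \<rho>_def A_def)
  moreover have "0 \<le> \<rho>" using l1 by (simp add: \<rho>_def le_max_iff_disj)
  moreover have "real D * l\<^sup>2 / n \<le> A * l\<^sup>2 + l ^ 3 / n"
  proof -
    have "real D * l\<^sup>2 / n \<le> (y + 1) * l\<^sup>2 / n" using Dy by (intro divide_right_mono mult_right_mono) auto
    also have "\<dots> = A * l\<^sup>2 + l\<^sup>2 / n" by (simp add: yA[symmetric] distrib_right add_divide_distrib)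
    also have "\<dots> \<le> A * l\<^sup>2 + l ^ 3 / n" using ll n0 by (simp add: divide_right_mono)
    finally show ?thesis .
  qed
  moreover have "l ^ 3 / real n \<le> \<rho>" by (simp add: \<rho>_def)
  ultimately show ?thesis by linarith
qed

theorem corollary1:
  shows "\<exists>C::real. 0 < C \<and> C \<le> 1 \<and>
    (\<forall>n::nat. n \<ge> 3 \<longrightarrow> (\<forall>s\<in>densities. \<forall>shat.
       rho_estimator n decreasing_densities shat \<longrightarrow>
       C * (\<integral>X. (hellinger s (shat X))\<^sup>2 \<partial>(\<Pi>\<^sub>M i\<in>{1..n}. density lborel (\<lambda>x. ennreal (s x)))) \<le>
       (INF Mbar\<in>{0..}. (hellinger_set s (bounded_decreasing_densities Mbar))\<^sup>2 +
          max (Mbar powr (1 / 3) * real n powr (- 2 / 3) * (ln (real n))\<^sup>2)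
              (1 / real n * (ln (real n)) ^ 3))))"
proof (intro exI[of _ "1 / 300000"] conjI allI impI ballI)
  fix n :: nat and s shat
  assume n: "3 \<le> n" and s: "s \<in> densities" and est: "rho_estimator n decreasing_densities shat"
  define R where "R = 1 / 300000 *
    (\<integral>X. (hellinger s (shat X))\<^sup>2 \<partial>(\<Pi>\<^sub>M i\<in>{1..n}. density lborel (\<lambda>x. ennreal (s x))))"
  define \<rho> where "\<rho> M = max (M powr (1 / 3) * real n powr (- 2 / 3) * (ln (real n))\<^sup>2)
    (1 / real n * (ln (real n)) ^ 3)" for M
  have "R \<le> (INF M\<in>{0..}. (hellinger_set s (bounded_decreasing_densities M))\<^sup>2 + \<rho> M)"
  proof (rule cINF_greatest)
    fix M :: real assume "M \<in> {0..}"
    then have M: "0 \<le> M" by simp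
    let ?B = "bounded_decreasing_densities M"
    \<comment> \<open>The square stands outside the infimum in \<open>hellinger_set\<close>, so the
      infimum is taken on square roots. \<open>sqrt\<close> is monotone on all reals, so
      \<open>R - \<rho> M\<close> may be negative here.\<close>
    have "sqrt (R - \<rho> M) \<le> hellinger s t" if t: "t \<in> ?B" for t
    proof -
      have "R \<le> (hellinger s t)\<^sup>2 + \<rho> M"
        using rho_estimator_risk[OF n s le_add2 est t, of "nat \<lfloor>(n * M) powr (1 / 3)\<rfloor>"]
          rate_of_pieces[OF n M] zero_le_power2[of "hellinger s t"]
        unfolding R_def \<rho>_def by linarith
      then show ?thesis
        unfolding hellinger_def[of s t]
        by (intro real_sqrt_le_mono) (simp add: hellinger_sq)
    qed
    then have le: "sqrt (R - \<rho> M) \<le> hellinger_set s ?B"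
      unfolding hellinger_set_def using bounded_decreasing_densities_nonempty[OF M]
      by (intro cINF_greatest)
    show "R \<le> (hellinger_set s ?B)\<^sup>2 + \<rho> M"
    proof (cases "\<rho> M \<le> R")
      case True
      then have "(sqrt (R - \<rho> M))\<^sup>2 \<le> (hellinger_set s ?B)\<^sup>2"
        using le by (intro power_mono) auto
      then show ?thesis using True by simp
    next
      case False
      then show ?thesis using zero_le_power2[of "hellinger_set s ?B"] by linarith
    qed
  qed simp
  then show "1 / 300000 * (\<integral>X. (hellinger s (shat X))\<^sup>2 \<partial>(\<Pi>\<^sub>M i\<in>{1..n}. density lborel (\<lambda>x. ennreal (s x)))) \<le>
       (INF Mbar\<in>{0..}. (hellinger_set s (bounded_decreasing_densities Mbar))\<^sup>2 +
          max (Mbar powr (1 / 3) * real n powr (- 2 / 3) * (ln (real n))\<^sup>2)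
              (1 / real n * (ln (real n)) ^ 3))"
    unfolding R_def \<rho>_def .
qed auto

end
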